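(* Let $n$ be a positive integer and let $v=4^n$ or $v=2p^n+2$ with $p\in\{7,31,127\}$. Then for every integer $m\ge 3$, $$C((m-1)v,6,3,m)\le \frac{v^2(v-1)(m-1)}{24}.$$
   Context: A $(V,k,t,m)$ cover is a pair $(X,\mathcal{B})$ with $|X|=V$ and $\mathcal{B}$ a collection of $k$-subsets of $X$ such that every $m$-subset of $X$ meets some block in at least $t$ points. $C(V,k,t,m)$ denotes the minimum number of blocks in a $(V,k,t,m)$ cover. *)

theory Defs
  imports Complex_Main
begin

text \<open>Blocks form a set rather than a multiset; repeated blocks never help in minimising
  the number of blocks.\<close>

definition is_cover :: "'a set \<Rightarrow> 'a set set \<Rightarrow> nat \<Rightarrow> nat \<Rightarrow> nat \<Rightarrow> nat \<Rightarrow> bool" where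
  "is_cover X \<B> V k t m \<longleftrightarrow>
     finite X \<and> card X = V \<and>
     (\<forall>B\<in>\<B>. B \<subseteq> X \<and> card B = k) \<and>
     (\<forall>S. S \<subseteq> X \<and> card S = m \<longrightarrow> (\<exists>B\<in>\<B>. t \<le> card (S \<inter> B)))"

text \<open>Every finite set is in bijection with a set of natural numbers, so restricting the
  points to \<^typ>\<open>nat\<close> loses no cover. The minimum is meaningful only when some cover with the
  given parameters exists; the lemmas below show this for \<open>t \<le> k \<le> V\<close> and \<open>t \<le> m\<close>.\<close>

definition cover_number :: "nat \<Rightarrow> nat \<Rightarrow> nat \<Rightarrow> nat \<Rightarrow> nat" where
  "cover_number V k t m =
     (LEAST b. \<exists>(X::nat set) \<B>. is_cover X \<B> V k t m \<and> card \<B> = b)"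

lemma is_cover_all_subsets:
  assumes "finite X" "t \<le> k" "k \<le> card X" "t \<le> m"
  shows "is_cover X {B. B \<subseteq> X \<and> card B = k} (card X) k t m"
proof -
  have "\<exists>B. B \<subseteq> X \<and> card B = k \<and> t \<le> card (S \<inter> B)" if S: "S \<subseteq> X" "card S = m" for S
  proof -
    obtain T where T: "T \<subseteq> S" "card T = t"
      using obtain_subset_with_card_n[of t S] S(2) assms(4) by metis
    have fin: "finite S"
      using S(1) assms(1) by (rule finite_subset)
    obtain B where B: "T \<subseteq> B" "B \<subseteq> X" "card B = k"
      using exists_subset_between[of T k X] T S(1) assms(1-3) by (metis subset_trans)
    have "card T \<le> card (S \<inter> B)"
      using T(1) B(1) fin by (intro card_mono finite_Int) simp_all
    with T(2) B(2,3) show ?thesis by blast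
  qed
  with assms(1) show ?thesis unfolding is_cover_def by blast
qed

lemma cover_number_attained:
  assumes "t \<le> k" "k \<le> V" "t \<le> m"
  shows "\<exists>(X::nat set) \<B>. is_cover X \<B> V k t m \<and> card \<B> = cover_number V k t m"
proof -
  have "is_cover {..<V} {B. B \<subseteq> {..<V} \<and> card B = k} V k t m"
    using is_cover_all_subsets[of "{..<V}" t k m] assms by (metis card_lessThan finite_lessThan)
  then have "\<exists>b (X::nat set) \<B>. is_cover X \<B> V k t m \<and> card \<B> = b"
    by blast
  from LeastI_ex[OF this] show ?thesis
    unfolding cover_number_def .
qed

end

(* Among m points distributed over m - 1 cyclically ordered groups, three lie in one group, or two lie in
   one group and a third lies in the next. Pair up the points of each group, assign to the j-th pair of a
   group a Steiner system S(2,4,v) on the preceding group, and take the unions of its blocks with that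
   pair. This gives the bound as soon as v/2 systems S(2,4,v) cover all triples of v points.

   For v = 4^n these systems are the colour classes of Baker's colouring of the planes of AG(2n,2).
   For v = 2q + 2 with q = p^n and p = 2^k - 1, k odd, take two copies of the projective line over GF(q)
   and glue along the blocks of the spherical geometry S(3,p+1,q+1), with colours in GF(q): a block through
   infinity (a line) carries Baker's classes on 2^(k+1) points, coloured by the points of the line; any
   other block (a circle) is a projective line over GF(p) and carries a PSL(2,p)-invariant set of
   quadruples coloured by its points, in which colour c covers the pairs of the circle without c. *)

theory Submission
  imports Defs
    "HOL-Library.Product_Plus"
    "HOL-Library.Cardinality"
    "HOL-Algebra.Algebraic_Closure_Type"
    "Berlekamp_Zassenhaus.Finite_Field"
begin

section \<open>Covers from families of quadruple systems\<close>

text \<open>The budget leaves no slack. The construction has (m - 1) v / 2 pairs with v (v - 1) / 12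
  blocks each, which is the bound itself, and no smaller number of quadruples covers all pairs of v
  points. Hence a class that covers all pairs within this budget is automatically an S(2,4,v), and
  only coverage and cardinality need proof.

  This is the obstacle in gluing: the lines through infinity and c have exactly these two points in
  common, so the systems of colour c on them must share the block above the two points. Baker's
  colours are renamed through cubes to achieve this. All pairs that involve c, and all pairs above
  one point, are then left to the lines.

  The arithmetic of p enters twice. Odd k makes cubing a permutation of GF(2^k), which Baker's
  colouring needs. For odd k > 1 the number p = 2^k - 1 is 7 modulo 12, so GF(p) has cube roots of
  unity while -1 is not a square, which the circles need. A line or circle has p + 1 points, and an
  arbitrary bijection may carry the small design to it.\<close>

definition quads :: "'a set \<Rightarrow> 'a set set" where
  "quads P = {B. B \<subseteq> P \<and> finite B \<and> card B \<le> 4}"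

text \<open>Blocks are later enlarged to six points, so an upper bound on their size suffices in
  \<open>quads\<close>; it also spares an injectivity argument whenever blocks are
  transported.\<close>

definition resolved :: "'a set \<Rightarrow> 'i set \<Rightarrow> ('i \<Rightarrow> 'a set set) \<Rightarrow> bool" where
  "resolved P I D \<longleftrightarrow>
     (\<forall>i\<in>I. D i \<subseteq> quads P \<and> (\<forall>x\<in>P. \<forall>y\<in>P. x \<noteq> y \<longrightarrow> (\<exists>B\<in>D i. {x, y} \<subseteq> B))) \<and>
     (\<forall>x\<in>P. \<forall>y\<in>P. \<forall>z\<in>P. x \<noteq> y \<and> x \<noteq> z \<and> y \<noteq> z \<longrightarrow> (\<exists>i\<in>I. \<exists>B\<in>D i. {x, y, z} \<subseteq> B))"

lemma finite_quads: "finite P \<Longrightarrow> finite (quads P)"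
  unfolding quads_def by (rule finite_subset[of _ "Pow P"]) auto

lemma resolved_image:
  assumes "resolved P I D" and f: "bij_betw f P Q"
  shows "resolved Q I (\<lambda>i. (`) f ` D i)"
  unfolding resolved_def
proof (intro conjI ballI impI)
  have Q: "Q = f ` P" using f by (simp add: bij_betw_def)
  note R = assms(1)[unfolded resolved_def]
  { fix i assume i: "i \<in> I"
    show "(`) f ` D i \<subseteq> quads Q"
    proof
      fix B assume "B \<in> (`) f ` D i"
      then obtain A where A: "A \<in> D i" "B = f ` A" by blast
      then have "A \<in> quads P" using R i by blast
      then show "B \<in> quads Q"
        using card_image_le[of A f] by (auto simp: quads_def Q A(2))
    qed
    fix x y assume "x \<in> Q" "y \<in> Q" "x \<noteq> y"
    then obtain a b where "a \<in> P" "b \<in> P" "a \<noteq> b" "x = f a" "y = f b" unfolding Q by blast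
    moreover from this R i obtain B where "B \<in> D i" "{a, b} \<subseteq> B" by blast
    ultimately show "\<exists>B\<in>(`) f ` D i. {x, y} \<subseteq> B" by blast
  }
  fix x y z assume "x \<in> Q" "y \<in> Q" "z \<in> Q" "x \<noteq> y \<and> x \<noteq> z \<and> y \<noteq> z"
  then obtain a b c where abc: "a \<in> P" "b \<in> P" "c \<in> P" "a \<noteq> b \<and> a \<noteq> c \<and> b \<noteq> c" "x = f a" "y = f b" "z = f c"
    unfolding Q by blast
  then obtain i B where "i \<in> I" "B \<in> D i" "{a, b, c} \<subseteq> B" using R by meson
  with abc show "\<exists>i\<in>I. \<exists>B\<in>(`) f ` D i. {x, y, z} \<subseteq> B" by blast
qed

text \<open>Both applications have v/2 - 1 colours but v/2 pairs in a group, so a colour has to be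
  repeated.\<close>

lemma ex_surj_lessThan:
  assumes "finite I" "I \<noteq> {}" "card I \<le> n"
  shows "\<exists>g. g ` {..<n::nat} = I"
proof -
  obtain h where h: "bij_betw h {..<card I} I"
    using ex_bij_betw_nat_finite[OF assms(1)] by (auto simp: atLeast0LessThan)
  obtain a where a: "a \<in> I" using assms(2) by blast
  have "(\<lambda>j. if j < card I then h j else a) ` {..<n} = I"
  proof (intro equalityI subsetI)
    fix i assume "i \<in> I"
    then obtain j where "j < card I" "i = h j" using h unfolding bij_betw_def by blast
    then show "i \<in> (\<lambda>j. if j < card I then h j else a) ` {..<n}"
      using assms(3) by (intro image_eqI[of _ _ j]) auto
  qed (use h a in \<open>auto simp: bij_betw_def\<close>)
  then show ?thesis by (intro exI)
qed

text \<open>Otherwise all values are at most 2 and every 2 is followed cyclically by a 0. The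
  successor map is injective, so there are at most as many 2s as 0s, and the sum is at most
  \<open>M\<close>.\<close>

lemma cyclic_pigeonhole:
  fixes a :: "nat \<Rightarrow> nat"
  assumes M: "M \<ge> 1" and sum: "(\<Sum>i<M. a i) > M"
  shows "\<exists>i<M. a i \<ge> 3 \<or> (a i \<ge> 2 \<and> a (Suc i mod M) \<ge> 1)"
proof (rule ccontr)
  assume "\<not> ?thesis"
  then have le: "a i \<le> 2" and z: "a i = 2 \<Longrightarrow> a (Suc i mod M) = 0" if "i < M" for i
    using that by (force simp: not_le)+
  let ?s = "\<lambda>i. Suc i mod M"
  have inj: "inj_on ?s {..<M}"
    by (rule inj_onI) (metis lessThan_iff mod_Suc nat.inject mod_less old.nat.distinct(2))
  have im: "?s ` {..<M} = {..<M}"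
    using M by (intro endo_inj_surj inj) auto
  have eq: "int (a i) = 1 + of_bool (a i = 2) - of_bool (a i = 0)" if "i < M" for i
    using le[OF that] by (cases "a i" rule: nat.exhaust; auto simp: le_Suc_eq numeral_2_eq_2)
  have "(\<Sum>i<M. of_bool (a i = 2)) \<le> (\<Sum>i<M. of_bool (a (?s i) = 0) :: int)"
    by (rule sum_mono) (auto simp: z)
  also have "\<dots> = (\<Sum>i<M. of_bool (a i = 0))"
    using sum.reindex[OF inj, of "\<lambda>i. of_bool (a i = 0) :: int"] im by (simp add: o_def)
  finally have "(\<Sum>i<M. int (a i)) \<le> int M"
    by (simp add: eq sum.distrib sum_subtractf)
  then show False using sum by (simp flip: of_nat_sum)
qed

lemma card_ge_2_obtain:
  assumes "card A \<ge> 2"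
  obtains x y where "x \<in> A" "y \<in> A" "x \<noteq> y"
proof -
  obtain T where "T \<subseteq> A" "card T = 2" using assms by (metis obtain_subset_with_card_n)
  then show thesis using that by (auto simp: card_2_iff)
qed

lemma card_ge_3_obtain:
  assumes "card A \<ge> 3"
  obtains x y z where "x \<in> A" "y \<in> A" "z \<in> A" "x \<noteq> y" "x \<noteq> z" "y \<noteq> z"
proof -
  obtain T where "T \<subseteq> A" "card T = 3" using assms by (metis obtain_subset_with_card_n)
  then show thesis using that by (auto simp: card_3_iff)
qed

lemma cover_number_le_resolved_nat:
  assumes R: "resolved {..<v} I D" and v: "even v" "v \<ge> 4"
    and I: "finite I" "I \<noteq> {}" "card I \<le> v div 2"
    and D: "\<And>i. i \<in> I \<Longrightarrow> 12 * card (D i) \<le> v * (v - 1)" and m: "m \<ge> 3"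
  shows "24 * cover_number ((m - 1) * v) 6 3 m \<le> v\<^sup>2 * (v - 1) * (m - 1)"
proof -
  obtain g where g: "g ` {..<v div 2} = I" using ex_surj_lessThan[OF I] by blast
  define M where "M = m - 1"
  have M: "M \<ge> 2" "m = M + 1" using m by (auto simp: M_def)
  let ?X = "{..<M * v}"
  \<comment> \<open>Group \<open>i\<close> is the interval of length \<open>v\<close> that starts at
    \<open>i * v\<close>; the quadruple lies in group \<open>i\<close> and the pair in the group
    after it.\<close>
  define base where "base = (\<lambda>(i, j, B). (\<lambda>x. i * v + x) ` B \<union>
     {(Suc i mod M) * v + 2 * j, (Suc i mod M) * v + 2 * j + 1})"
  define idx where "idx = (SIGMA i:{..<M}. SIGMA j:{..<v div 2}. D (g j))"
  note R1 = R[unfolded resolved_def]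
  have in_grp: "i * v + x < M * v" if "i < M" "x < v" for i x
  proof -
    have "i * v + x < Suc i * v" using that by simp
    also have "\<dots> \<le> M * v" using that by (intro mult_right_mono) auto
    finally show ?thesis .
  qed
  have base: "base t \<subseteq> ?X \<and> card (base t) \<le> 6" if "t \<in> idx" for t
  proof -
    obtain i j B where t: "t = (i, j, B)" and ij: "i < M" "j < v div 2" and B: "B \<in> D (g j)"
      using \<open>t \<in> idx\<close> by (auto simp: idx_def)
    have "g j \<in> I" using g ij by blast
    then have Bq: "B \<subseteq> {..<v}" "finite B" "card B \<le> 4" using R1 B by (auto simp: quads_def)
    have s: "Suc i mod M < M" using M by simp
    have "2 * j + 1 < v" using ij v by auto
    then have "base t \<subseteq> ?X"
      using Bq in_grp ij(1) in_grp[OF s, of "2 * j"] in_grp[OF s, of "2 * j + 1"]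
      by (auto simp: base_def t add.assoc)
    moreover have "card (base t) \<le> 4 + 2"
      unfolding base_def t prod.case
      by (rule order_trans[OF card_Un_le], rule add_mono)
        (use Bq card_image_le[of B] in \<open>auto intro: order_trans simp: card_insert_if\<close>)
    ultimately show ?thesis by simp
  qed
  \<comment> \<open>Since m is at least 3 there are two groups, hence at least 8 points, enough to
    fill every base up to exactly 6.\<close>
  have "M * v \<ge> 2 * 4" using M v by (intro mult_mono) auto
  then have "\<exists>C. base t \<subseteq> C \<and> C \<subseteq> ?X \<and> card C = 6" if "t \<in> idx" for t
    using exists_subset_between[of "base t" 6 ?X] base[OF that] by auto
  then obtain ext where ext: "\<And>t. t \<in> idx \<Longrightarrow> base t \<subseteq> ext t \<and> ext t \<subseteq> ?X \<and> card (ext t) = 6"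
    by metis
  have fD: "finite (D i)" if "i \<in> I" for i
    using R1 that finite_quads[of "{..<v}"] by (meson finite_lessThan finite_subset)
  have fin: "finite idx" unfolding idx_def using fD g by (intro finite_SigmaI) auto
  have "card idx = (\<Sum>i<M. \<Sum>j<v div 2. card (D (g j)))"
  proof -
    have "finite (D (g j))" if "j < v div 2" for j using fD g that by blast
    then show ?thesis
      unfolding idx_def by (subst card_SigmaI; (intro finite_SigmaI ballI)?; simp add: card_SigmaI)
  qed
  then have "12 * card idx = (\<Sum>i<M. \<Sum>j<v div 2. 12 * card (D (g j)))"
    by (simp add: sum_distrib_left mult_ac)
  also have "\<dots> \<le> (\<Sum>i<M. \<Sum>j<v div 2. v * (v - 1))"
    using D g by (intro sum_mono) blast
  also have "\<dots> = M * (v div 2) * (v * (v - 1))" by simp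
  finally have "24 * card idx \<le> 2 * (M * (v div 2) * (v * (v - 1)))" by linarith
  also have "\<dots> = M * (2 * (v div 2)) * (v * (v - 1))" by (simp only: mult_ac)
  also have "2 * (v div 2) = v" using v by simp
  finally have cnt: "24 * card idx \<le> v\<^sup>2 * (v - 1) * M" by (simp add: power2_eq_square mult_ac)
  have "\<exists>B\<in>ext ` idx. 3 \<le> card (S \<inter> B)" if S: "S \<subseteq> ?X" "card S = m" for S
  proof -
    have fS: "finite S" using S(1) finite_subset by blast
    define grp where "grp = (\<lambda>i. {x \<in> S. x div v = i})"
    have "S = (\<Union>i<M. grp i)"
      using S v by (auto simp: grp_def less_mult_imp_div_less)
    then have "card S = (\<Sum>i<M. card (grp i))"
      using fS by (subst card_UN_disjoint[symmetric]) (auto simp: grp_def)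
    then obtain i where i: "i < M" "card (grp i) \<ge> 3 \<or> (card (grp i) \<ge> 2 \<and> card (grp (Suc i mod M)) \<ge> 1)"
      using cyclic_pigeonhole[of M "\<lambda>i. card (grp i)"] S M by auto
    have repr: "i * v + x mod v = x" if "x \<in> grp i" for x i
      using that by (auto simp: grp_def)
    have modv: "x mod v < v" for x using v by simp
    have T: "\<exists>t\<in>idx. \<exists>T. T \<subseteq> S \<inter> base t \<and> card T = 3"
      using i(2)
    proof
      assume "card (grp i) \<ge> 3"
      then obtain x y z where xyz: "x \<in> grp i" "y \<in> grp i" "z \<in> grp i" "x \<noteq> y" "x \<noteq> z" "y \<noteq> z"
        by (rule card_ge_3_obtain)
      then have "x mod v \<noteq> y mod v" "x mod v \<noteq> z mod v" "y mod v \<noteq> z mod v"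
        using repr by metis+
      then obtain k B where k: "k \<in> I" "B \<in> D k" "{x mod v, y mod v, z mod v} \<subseteq> B"
        using R1 modv by (meson lessThan_iff)
      obtain j where j: "j < v div 2" "g j = k" using g k(1) by auto
      have "(i, j, B) \<in> idx" using i(1) j k by (simp add: idx_def)
      moreover have "{x, y, z} \<subseteq> S" using xyz by (auto simp: grp_def)
      moreover have "{x, y, z} \<subseteq> base (i, j, B)"
        using k(3) repr[OF xyz(1)] repr[OF xyz(2)] repr[OF xyz(3)] by (force simp: base_def)
      moreover have "card {x, y, z} = 3" using xyz by simp
      ultimately show ?thesis by blast
    next
      assume "card (grp i) \<ge> 2 \<and> card (grp (Suc i mod M)) \<ge> 1"
      then obtain x y z where xyz: "x \<in> grp i" "y \<in> grp i" "x \<noteq> y" "z \<in> grp (Suc i mod M)"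
        by (metis card_ge_2_obtain card.empty equals0I not_one_le_zero)
      then have "x mod v \<noteq> y mod v" using repr by metis
      \<comment> \<open>Pair j of a group consists of its points 2 j and 2 j + 1, so this is the
        pair that contains \<open>z\<close>.\<close>
      let ?j = "(z mod v) div 2"
      have j: "?j < v div 2" using modv[of z] v by (subst div_less_iff_less_mult) auto
      then have "g ?j \<in> I" using g by blast
      then obtain B where B: "B \<in> D (g ?j)" "{x mod v, y mod v} \<subseteq> B"
        using R1 modv \<open>x mod v \<noteq> y mod v\<close> by (meson lessThan_iff)
      have "(i, ?j, B) \<in> idx" using i(1) j B by (simp add: idx_def)
      moreover have "{x, y, z} \<subseteq> S" using xyz by (auto simp: grp_def)
      moreover have "{x, y, z} \<subseteq> base (i, ?j, B)"
      proof -
        have "z mod v = 2 * ?j \<or> z mod v = 2 * ?j + 1"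
          using div_mult_mod_eq[of "z mod v" 2] by linarith
        then have "z = Suc i mod M * v + 2 * ?j \<or> z = Suc i mod M * v + 2 * ?j + 1"
          using repr[OF xyz(4)] by linarith
        moreover have "x \<in> (\<lambda>x. i * v + x) ` B" "y \<in> (\<lambda>x. i * v + x) ` B"
          using B(2) repr[OF xyz(1)] repr[OF xyz(2)] by (auto intro: image_eqI[OF sym])
        ultimately show ?thesis by (auto simp: base_def)
      qed
      \<comment> \<open>A single group would be its own successor; with two or more,
        \<open>z\<close> differs from \<open>x\<close> and \<open>y\<close>.\<close>
      moreover have "i \<noteq> Suc i mod M" using i(1) M by (auto simp: mod_Suc)
      then have "card {x, y, z} = 3" using xyz by (auto simp: grp_def card_insert_if)
      ultimately show ?thesis by blast
    qed
    then obtain t T where t: "t \<in> idx" "T \<subseteq> S \<inter> base t" "card T = 3" by blast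
    then have "T \<subseteq> S \<inter> ext t" using ext[OF t(1)] by blast
    then have "card T \<le> card (S \<inter> ext t)" using fS by (intro card_mono) auto
    with t show ?thesis by auto
  qed
  then have "is_cover ?X (ext ` idx) ((m - 1) * v) 6 3 m"
    unfolding is_cover_def using ext by (auto simp: M_def)
  then have "cover_number ((m - 1) * v) 6 3 m \<le> card (ext ` idx)"
    unfolding cover_number_def by (intro Least_le) blast
  also have "\<dots> \<le> card idx" using fin by (rule card_image_le)
  finally show ?thesis using cnt unfolding M_def by simp
qed

lemma cover_number_le_resolved:
  assumes R: "resolved P I D" and P: "finite P" "card P = v" and v: "even v" "v \<ge> 4"
    and I: "finite I" "I \<noteq> {}" "card I \<le> v div 2"
    and D: "\<And>i. i \<in> I \<Longrightarrow> 12 * card (D i) \<le> v * (v - 1)" and m: "m \<ge> 3"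
  shows "real (cover_number ((m - 1) * v) 6 3 m) \<le> (real v)\<^sup>2 * (real v - 1) * (real m - 1) / 24"
proof -
  obtain f where f: "bij_betw f P {..<v}"
    using ex_bij_betw_finite_nat[OF P(1)] P(2) by (auto simp: atLeast0LessThan)
  have "12 * card ((`) f ` D i) \<le> v * (v - 1)" if "i \<in> I" for i
  proof -
    have "D i \<subseteq> quads P" using R that by (auto simp: resolved_def)
    then have "finite (D i)" using finite_quads[OF P(1)] finite_subset by blast
    then have "card ((`) f ` D i) \<le> card (D i)" by (rule card_image_le)
    then show ?thesis using D[OF that] by linarith
  qed
  then have "24 * cover_number ((m - 1) * v) 6 3 m \<le> v\<^sup>2 * (v - 1) * (m - 1)"
    by (intro cover_number_le_resolved_nat[OF resolved_image[OF R f] v I _ m])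
  then have "real (24 * cover_number ((m - 1) * v) 6 3 m) \<le> real (v\<^sup>2 * (v - 1) * (m - 1))"
    by (rule of_nat_mono)
  then show ?thesis using v m by (simp add: of_nat_diff)
qed

section \<open>Finite subfields of an algebraically closed field\<close>

text \<open>A field of order p^n with variable n cannot be a type here, so it is a subset of the
  algebraic closure of its prime field: the fixed points of a power of Frobenius.\<close>

definition subfield_set :: "'a::field set \<Rightarrow> bool" where
  "subfield_set S \<longleftrightarrow> 0 \<in> S \<and> 1 \<in> S \<and> (\<forall>x\<in>S. \<forall>y\<in>S. x + y \<in> S \<and> x * y \<in> S) \<and>
     (\<forall>x\<in>S. - x \<in> S \<and> inverse x \<in> S)"

lemma subfield_setD:
  assumes "subfield_set S"
  shows "0 \<in> S" "1 \<in> S" "x \<in> S \<Longrightarrow> y \<in> S \<Longrightarrow> x + y \<in> S" "x \<in> S \<Longrightarrow> y \<in> S \<Longrightarrow> x * y \<in> S"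
    "x \<in> S \<Longrightarrow> - x \<in> S" "x \<in> S \<Longrightarrow> inverse x \<in> S" "x \<in> S \<Longrightarrow> y \<in> S \<Longrightarrow> x - y \<in> S"
    "x \<in> S \<Longrightarrow> y \<in> S \<Longrightarrow> x / y \<in> S" "x \<in> S \<Longrightarrow> x ^ n \<in> S"
proof -
  show *: "0 \<in> S" "1 \<in> S" "x \<in> S \<Longrightarrow> y \<in> S \<Longrightarrow> x + y \<in> S" "x \<in> S \<Longrightarrow> y \<in> S \<Longrightarrow> x * y \<in> S" for x y
    using assms by (auto simp: subfield_set_def)
  show "x \<in> S \<Longrightarrow> - x \<in> S" "x \<in> S \<Longrightarrow> inverse x \<in> S"
    using assms by (auto simp: subfield_set_def)
  show "x \<in> S \<Longrightarrow> y \<in> S \<Longrightarrow> x - y \<in> S"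
    using assms by (metis (no_types, lifting) subfield_set_def diff_conv_add_uminus)
  show "x \<in> S \<Longrightarrow> y \<in> S \<Longrightarrow> x / y \<in> S"
    using assms by (metis (no_types, lifting) subfield_set_def divide_inverse)
  show "x \<in> S \<Longrightarrow> x ^ n \<in> S" by (induction n) (use * in auto)
qed

lemma subfield_set_frobenius_fixed:
  assumes "prime CHAR('a::field)"
  shows "subfield_set {x::'a. x ^ (CHAR('a) ^ n) = x}"
proof -
  let ?q = "CHAR('a) ^ n"
  have add: "(x + y) ^ ?q = x ^ ?q + y ^ ?q" for x y :: 'a
    by (rule freshmans_dream'[OF assms refl])
  have q: "?q > 0" using assms by (simp add: prime_gt_0_nat)
  \<comment> \<open>Obtained from additivity rather than from the parity of \<open>?q\<close>, so
    that characteristic 2 is included.\<close>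
  have "(- x) ^ ?q = - (x ^ ?q)" for x :: 'a
    using add[of "- x" x] q by (simp only: eq_neg_iff_add_eq_0) (simp add: zero_power)
  then show ?thesis
    using q add by (auto simp: subfield_set_def power_0_left power_mult_distrib power_inverse)
qed

text \<open>The polynomial \<open>X\<^sup>q - X\<close> is separable, its derivative being \<open>-1\<close>.\<close>

lemma card_frobenius_fixed:
  assumes p: "prime CHAR('a::alg_closed_field)" and n: "n \<ge> 1"
  shows "card {x::'a. x ^ (CHAR('a) ^ n) = x} = CHAR('a) ^ n"
proof -
  let ?q = "CHAR('a) ^ n"
  have q: "?q > 1" using n by (intro one_less_power prime_gt_1_nat p) auto
  define f where "f = monom 1 ?q - monom (1::'a) 1"
  have deg: "degree f = ?q"
    unfolding f_def using q
    by (subst diff_conv_add_uminus, subst degree_add_eq_left) (auto simp: degree_monom_eq)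
  then have f0: "f \<noteq> 0" using q by (metis degree_0 not_one_less_zero)
  \<comment> \<open>As n is positive, the characteristic divides \<open>?q\<close> and kills the
    derivative of the leading term.\<close>
  have pd: "pderiv f = -1"
    using n by (simp add: f_def pderiv_diff pderiv_monom monom_0 power_0_left one_pCons of_nat_power)
  have ord: "order x f \<le> 1" for x
  proof (rule ccontr)
    assume "\<not> ?thesis"
    then have "[:- x, 1:] ^ 2 dvd f" using order_divides by (metis not_less_eq_eq numeral_2_eq_2 One_nat_def)
    then obtain g where g: "f = [:- x, 1:] ^ 2 * g" by blast
    define h where "h = [:- x, 1:]"
    have "f = h * (h * g)" unfolding g h_def power2_eq_square by (simp only: mult.assoc)
    then have "poly (pderiv f) x = 0" by (simp add: pderiv_mult) (simp add: h_def)
    then show False by (simp add: pd)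
  qed
  obtain A where A: "size A = degree f" "f = smult (lead_coeff f) (\<Prod>x\<in>#A. [:- x, 1:])"
    using alg_closed_imp_factorization[OF f0] by blast
  have "proots f = A"
  proof -
    have "proots f = proots (\<Prod>x\<in>#A. [:- x, 1:])"
      using A(2) f0 by (metis leading_coeff_0_iff proots_smult)
    also have "\<dots> = A"
    proof -
      have "proots (\<Prod>x\<in>#B. [:- x, 1:]) = B \<and> (\<Prod>x\<in>#B. [:- x, 1::'a:]) \<noteq> 0" for B
      proof (induction B)
        case (add b B)
        then show ?case by (simp add: proots_mult del: mult_pCons_left)
      qed simp
      then show ?thesis by blast
    qed
    finally show ?thesis .
  qed
  \<comment> \<open>The size counts roots with multiplicity; since all orders are at most 1, it is
    the number of distinct roots.\<close>
  then have "size (proots f) = ?q" using A deg by simp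
  moreover have "size (proots f) = (\<Sum>x\<in>set_mset (proots f). count (proots f) x)"
    by (rule size_multiset_overloaded_eq)
  moreover have "\<dots> = (\<Sum>x\<in>set_mset (proots f). 1)"
  proof (rule sum.cong)
    fix x assume "x \<in># proots f"
    then have "count (proots f) x > 0" by simp
    then show "count (proots f) x = 1" using ord[of x] f0 by simp
  qed simp
  moreover have "set_mset (proots f) = {x. x ^ ?q = x}"
    using f0 by (auto simp: f_def poly_monom)
  ultimately show ?thesis by simp
qed

section \<open>Baker's families of planes\<close>

lemma resolved_reindex:
  assumes "resolved P I D" "g ` J = I"
  shows "resolved P J (\<lambda>j. D (g j))"
proof -
  have "g j \<in> I" if "j \<in> J" for j using assms(2) that by blast
  moreover have "\<exists>j\<in>J. \<exists>B\<in>D (g j). {x, y, z} \<subseteq> B"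
    if xyz: "x \<in> P" "y \<in> P" "z \<in> P" "x \<noteq> y \<and> x \<noteq> z \<and> y \<noteq> z" for x y z
  proof -
    obtain i B where "i \<in> I" "B \<in> D i" "{x, y, z} \<subseteq> B"
      using assms(1) xyz unfolding resolved_def by meson
    then show ?thesis using assms(2) by blast
  qed
  ultimately show ?thesis using assms(1) unfolding resolved_def by simp
qed

text \<open>Distinct blocks contain disjoint sets of ordered pairs. The bound refers to covered
  pairs only, because the circles through a point c miss the pairs that lie on a line with
  c.\<close>

lemma packing_bound:
  assumes V: "finite V" and D: "\<And>B. B \<in> D \<Longrightarrow> B \<subseteq> V \<and> card B = k"
    and uniq: "\<And>B C x y. B \<in> D \<Longrightarrow> C \<in> D \<Longrightarrow> x \<noteq> y \<Longrightarrow> {x, y} \<subseteq> B \<Longrightarrow> {x, y} \<subseteq> C \<Longrightarrow> B = C"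
  shows "card D * (k * (k - 1)) \<le> card {(x, y). x \<in> V \<and> y \<in> V \<and> x \<noteq> y \<and> (\<exists>B\<in>D. {x, y} \<subseteq> B)}"
proof -
  define pr where "pr = (\<lambda>B::'a set. {(x, y). x \<in> B \<and> y \<in> B \<and> x \<noteq> y})"
  have fin: "finite B" if "B \<in> D" for B using D[OF that] V finite_subset by blast
  have prc: "card (pr B) = k * (k - 1)" if "B \<in> D" for B
  proof -
    have "pr B = (SIGMA x:B. B - {x})" by (auto simp: pr_def)
    then show ?thesis using fin[OF that] D[OF that] by (simp add: card_SigmaI)
  qed
  have fD: "finite D" by (rule finite_subset[of _ "Pow V"]) (use D V in auto)
  have "card D * (k * (k - 1)) = (\<Sum>B\<in>D. card (pr B))" using prc by simp
  also have "\<dots> = card (\<Union>B\<in>D. pr B)"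
  proof (rule card_UN_disjoint[symmetric, OF fD])
    show "\<forall>B\<in>D. finite (pr B)"
    proof
      fix B assume "B \<in> D"
      show "finite (pr B)"
        by (rule finite_subset[of _ "B \<times> B"]) (use fin[OF \<open>B \<in> D\<close>] in \<open>auto simp: pr_def\<close>)
    qed
    show "\<forall>B\<in>D. \<forall>C\<in>D. B \<noteq> C \<longrightarrow> pr B \<inter> pr C = {}"
    proof (intro ballI impI, rule ccontr)
      fix B C assume BC: "B \<in> D" "C \<in> D" "B \<noteq> C" "pr B \<inter> pr C \<noteq> {}"
      then obtain x y where "x \<noteq> y" "{x, y} \<subseteq> B" "{x, y} \<subseteq> C" by (auto simp: pr_def)
      with uniq BC show False by blast
    qed
  qed
  also have "(\<Union>B\<in>D. pr B) = {(x, y). x \<in> V \<and> y \<in> V \<and> x \<noteq> y \<and> (\<exists>B\<in>D. {x, y} \<subseteq> B)}"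
    using D by (auto simp: pr_def)
  finally show ?thesis by simp
qed

lemma card_pairs_le:
  assumes "finite V"
  shows "card {(x, y). x \<in> V \<and> y \<in> V \<and> x \<noteq> y \<and> Q x y} \<le> card V * (card V - 1)"
proof -
  have "card {(x, y). x \<in> V \<and> y \<in> V \<and> x \<noteq> y \<and> Q x y} \<le> card (SIGMA x:V. V - {x})"
    using assms by (intro card_mono) auto
  then show ?thesis using assms by (simp add: card_SigmaI)
qed

lemma surj_from_small_fibres:
  assumes fin: "finite V" "finite T" and f: "f ` V \<subseteq> T" and card: "card V = c * card T"
    and fibre: "\<And>t. card {x \<in> V. f x = t} \<le> c" and c: "c > 0"
  shows "f ` V = T"
proof (rule ccontr)
  assume "f ` V \<noteq> T"
  then have "card (f ` V) < card T" using f fin by (simp add: psubset_card_mono psubset_eq)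
  have "card V = (\<Sum>t\<in>f ` V. card {x \<in> V. f x = t})"
    using sum.group[of V "f ` V" f "\<lambda>_. 1::nat"] fin by simp
  also have "\<dots> \<le> card (f ` V) * c" using sum_bounded_above[OF fibre] by simp
  also have "\<dots> < card T * c" using \<open>card (f ` V) < card T\<close> c by simp
  finally show False using card by simp
qed

text \<open>\<open>S\<close> is GF(2^k) inside a larger field. Odd k makes 3 coprime to 2^k - 1, so
  1 is the only cube root of unity in \<open>S\<close>; the injectivity of Baker's colours comes
  down to this.\<close>

locale odd_binary_field =
  fixes S :: "'a::field set" and k :: nat
  assumes S: "subfield_set S" and cardS: "card S = 2 ^ k" and frob: "x \<in> S \<Longrightarrow> x ^ (2 ^ k) = x"
    and two: "(1::'a) + 1 = 0" and k: "odd k"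
begin

lemmas S_closed [simp] = subfield_setD[OF S]

lemma finite_S [simp]: "finite S" using cardS by (intro card_ge_0_finite) simp

lemma add_self [simp]: "(x::'a) + x = 0"
proof -
  have "x + x = x * (1 + 1)" by (simp only: distrib_left mult_1_right)
  then show ?thesis using two by simp
qed

lemma add_self_left [simp]: "(x::'a) + (x + y) = y"
  by (simp flip: add.assoc)

lemma eq_iff_add_0: "(x::'a) = y \<longleftrightarrow> x + y = 0"
  by (metis add_self add_self_left add.right_neutral)

lemma two_eq_0 [simp]: "(2::'a) = 0"
  using two by (simp only: one_add_one)

lemma cube_eq: assumes "x \<in> S" "y \<in> S" "x ^ 3 = y ^ 3" shows "x = y"
proof (cases "y = 0")
  case False
  define z where "z = x / y"
  have z: "z \<in> S" "z ^ 3 = 1" "z \<noteq> 0" using assms False by (auto simp: z_def power_divide)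
  obtain j where j: "k = Suc (2 * j)" using k by (auto elim: oddE)
  \<comment> \<open>For odd k the number 2^k is 2 modulo 3, so a cube root of unity satisfies z =
    z^(2^k) = z^2.\<close>
  have "(2::nat) * 4 ^ j mod 3 = 2"
    by (induction j) (simp_all add: mod_mult_eq, presburger)
  then have "(2::nat) ^ k mod 3 = 2" by (simp add: j power_mult)
  then obtain t where t: "(2::nat) ^ k = 3 * t + 2" by (metis mult_div_mod_eq)
  have "z = z ^ (3 * t + 2)" using frob[OF z(1)] t by simp
  also have "\<dots> = z ^ 2" using z(2) by (simp only: power_add power_mult power_one mult_1)
  finally have "z = 1" using z(3) by (simp add: power2_eq_square)
  then show ?thesis using False by (simp add: z_def)
qed (use assms in auto)

text \<open>The quadratic form divides b^3 + a^3, so a zero forces equal cubes, hence a = b, where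
  the form takes the value a^2.\<close>

lemma no_root:
  assumes "a \<in> S" "b \<in> S" "b ^ 2 + a * b + a ^ 2 = 0"
  shows "a = 0"
proof -
  have "b ^ 3 + a ^ 3 = (b + a) * (b ^ 2 + a * b + a ^ 2)"
    by (simp add: algebra_simps power2_eq_square power3_eq_cube)
  then have "b ^ 3 = a ^ 3" using assms(3) eq_iff_add_0 by simp
  then have "b = a" using cube_eq assms by blast
  then show ?thesis using assms(3) by (simp add: power2_eq_square)
qed

definition V :: "('a \<times> 'a) set" where "V = S \<times> {0, 1}"

text \<open>Baker's colouring of the planes of an affine space over \<open>GF(2)\<close>, extracted from the Preparata code.
  The two levels are encoded by the field elements 0 and 1, which makes the colour of the plane with
  directions \<open>A\<close> and \<open>B\<close> a polynomial in their coordinates.\<close>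

fun kap :: "'a \<times> 'a \<Rightarrow> 'a \<times> 'a \<Rightarrow> 'a" where
  "kap (a, \<alpha>) (b, \<beta>) = (1 + \<alpha> * \<beta>) * (a ^ 2 * b + a * b ^ 2) + \<alpha> * b ^ 3 + \<beta> * a ^ 3"

lemma finite_V: "finite V" and card_V: "card V = 2 * 2 ^ k"
  by (simp_all add: V_def cardS)

lemma V_add [simp]: "A \<in> V \<Longrightarrow> B \<in> V \<Longrightarrow> A + B \<in> V"
  using two by (auto simp: V_def)

lemma pair_add_self [simp]: "(A :: 'a \<times> 'a) + A = 0"
  by (cases A) (simp add: zero_prod_def)

lemma pair_add_self_left [simp]: "(A :: 'a \<times> 'a) + (A + B) = B"
  by (simp flip: add.assoc)

lemma kap_in: "A \<in> V \<Longrightarrow> B \<in> V \<Longrightarrow> kap A B \<in> S"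
  by (auto simp: V_def)

lemma kap_commute: "kap A B = kap B A"
  by (cases A; cases B) (simp add: algebra_simps)

lemma kap_0 [simp]: "kap A 0 = 0"
  by (cases A) (simp add: zero_prod_def)

text \<open>Together with \<open>kap_commute\<close> this makes the colour independent of the basis:
  the exchange and the shear generate GL(2,2), so \<open>kap\<close> depends only on the direction
  space.\<close>

lemma kap_shift: assumes "A \<in> V" "B \<in> V" shows "kap A (A + B) = kap A B"
  using assms by (auto simp: V_def algebra_simps power2_eq_square power3_eq_cube)

text \<open>The key property of the colouring: a direction and a colour determine the plane through
  a given point. At level 0 of \<open>A\<close> the colour is quadratic in the second direction; at
  level 1 it is a cube up to a constant, once the level of the second direction is fixed.\<close>

lemma kap_eq:
  assumes A: "A \<in> V" "A \<noteq> 0" and B: "B \<in> V" and C: "C \<in> V" and eq: "kap A B = kap A C"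
  shows "C = B \<or> C = A + B"
proof -
  obtain a \<alpha> where Aa: "A = (a, \<alpha>)" "a \<in> S" "\<alpha> \<in> {0, 1}" using A by (auto simp: V_def)
  obtain b \<beta> where Bb: "B = (b, \<beta>)" "b \<in> S" "\<beta> \<in> {0, 1}" using B by (auto simp: V_def)
  obtain c \<gamma> where Cc: "C = (c, \<gamma>)" "c \<in> S" "\<gamma> \<in> {0, 1}" using C by (auto simp: V_def)
  show ?thesis
  proof (cases "\<alpha> = 0")
    case True
    then have a: "a \<noteq> 0" using A Aa by (simp add: zero_prod_def)
    define d where "d = b + c"
    have c: "c = b + d" by (simp add: d_def)
    have "a * (d ^ 2 + a * d + (\<beta> + \<gamma>) * a ^ 2) = kap A B + kap A C"
      unfolding Aa Bb Cc True c by (simp add: algebra_simps power2_eq_square power3_eq_cube)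
    then have d: "d ^ 2 + a * d + (\<beta> + \<gamma>) * a ^ 2 = 0" using eq a by simp
    show ?thesis
    proof (cases "\<beta> = \<gamma>")
      case eq: True
      then have "d * (a + d) = 0" using d by (simp add: algebra_simps power2_eq_square)
      then have "b = c \<or> a = d" using eq_iff_add_0 by (auto simp: d_def)
      then show ?thesis using eq by (auto simp: Aa Bb Cc True d_def algebra_simps)
    next
      case False
      then have "\<beta> + \<gamma> = 1" using Bb Cc by auto
      then have "a = 0" using no_root[of a d] d Aa Bb Cc by (simp add: d_def)
      then show ?thesis using a by simp
    qed
  next
    case False
    then have \<alpha>: "\<alpha> = 1" using Aa by simp
    have same: "x = y" if "kap A (x, \<delta>) = kap A (y, \<delta>)" "x \<in> S" "y \<in> S" "\<delta> \<in> {0, 1}" for x y \<delta>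
    proof (cases "\<delta> = 0")
      case True
      have "kap A (x, \<delta>) = (a + x) ^ 3 + a ^ 3" for x
        unfolding Aa \<alpha> True by (simp add: algebra_simps power2_eq_square power3_eq_cube)
      then have "(a + x) ^ 3 = (a + y) ^ 3" using that(1) by simp
      then show ?thesis using cube_eq[of "a + x" "a + y"] that Aa by simp
    next
      case False
      then have "\<delta> = 1" using that by simp
      then have "kap A (x, \<delta>) = x ^ 3 + a ^ 3" for x using two by (simp add: Aa \<alpha>)
      then show ?thesis using cube_eq[of x y] that by simp
    qed
    show ?thesis
    proof (cases "\<beta> = \<gamma>")
      case True
      then show ?thesis using same[of b \<gamma> c] eq Bb Cc by simp
    next
      case False
      then have \<beta>: "\<beta> = 1 + \<gamma>" using Bb Cc two by auto
      \<comment> \<open>Adding \<open>A\<close> flips the level, so \<open>C\<close> may be replaced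
        by \<open>A + C\<close>, which is at the level of \<open>B\<close>.\<close>
      have "kap A (a + c, \<beta>) = kap A C"
        using kap_shift[OF A(1) C] by (simp add: Aa Cc \<alpha> \<beta>)
      then have "b = a + c" using same[of b \<beta> "a + c"] eq Aa Bb Cc by simp
      then have "B = A + C" by (simp add: Aa Bb Cc \<alpha> \<beta>)
      then show ?thesis by simp
    qed
  qed
qed

text \<open>By \<open>kap_eq\<close> each fibre has at most two elements, while \<open>V\<close> is
  twice as large as \<open>S\<close>. Surjectivity is what makes each colour cover every
  pair.\<close>

lemma kap_surj:
  assumes "A \<in> V" "A \<noteq> 0"
  shows "kap A ` V = S"
proof (rule surj_from_small_fibres[of _ _ _ 2])
  fix t
  show "card {B \<in> V. kap A B = t} \<le> 2"
  proof (cases "{B \<in> V. kap A B = t} = {}")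
    case False
    then obtain B where "B \<in> V" "kap A B = t" by blast
    then have "C = B \<or> C = A + B" if "C \<in> V" "kap A C = t" for C
      using kap_eq[OF assms, of B C] that by simp
    then have "{B \<in> V. kap A B = t} \<subseteq> {B, A + B}" by blast
    then have "card {B \<in> V. kap A B = t} \<le> card {B, A + B}" by (rule card_mono[rotated]) simp
    then show ?thesis by (rule order_trans) (simp add: card_insert_if)
  qed (simp only: card.empty)
qed (use assms in \<open>auto simp: finite_V card_V cardS kap_in\<close>)

section \<open>Colour classes of planes in AG(k + 1, 2)\<close>

definition plane :: "'a \<times> 'a \<Rightarrow> 'a \<times> 'a \<Rightarrow> 'a \<times> 'a \<Rightarrow> ('a \<times> 'a) set" where
  "plane P A B = {P, P + A, P + B, P + (A + B)}"

definition planes :: "'a \<Rightarrow> ('a \<times> 'a) set set" where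
  "planes c = {plane P A B | P A B. P \<in> V \<and> A \<in> V \<and> B \<in> V \<and> kap A B = c}"

lemma planesI: "P \<in> V \<Longrightarrow> A \<in> V \<Longrightarrow> B \<in> V \<Longrightarrow> plane P A B \<in> planes (kap A B)"
  unfolding planes_def by blast

lemma planes_base:
  assumes "M \<in> planes c" "x \<in> M"
  obtains A B where "A \<in> V" "B \<in> V" "kap A B = c" "M = plane x A B" "x \<in> V"
proof -
  obtain P A B where M: "M = plane P A B" and V: "P \<in> V" "A \<in> V" "B \<in> V" and c: "kap A B = c"
    using assms(1) by (auto simp: planes_def)
  have "plane P A B = plane (P + A) A B" "plane P A B = plane (P + B) A B"
    "plane P A B = plane (P + (A + B)) A B"
    unfolding plane_def by (auto simp: ac_simps)
  moreover have "x = P \<or> x = P + A \<or> x = P + B \<or> x = P + (A + B)"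
    using assms(2) by (auto simp: M plane_def)
  ultimately have "M = plane x A B" "x \<in> V" using V by (auto simp: M)
  then show thesis using that V c by blast
qed

text \<open>Any two points of a plane can serve as base point and end of the first direction, which
  reduces questions about pairs to the map \<open>kap (x + y)\<close>.\<close>

lemma planes_pair:
  assumes "M \<in> planes c" "x \<in> M" "y \<in> M" "x \<noteq> y"
  obtains B where "B \<in> V" "kap (x + y) B = c" "M = plane x (x + y) B" "x \<in> V" "y \<in> V"
proof -
  obtain A B where AB: "A \<in> V" "B \<in> V" "kap A B = c" "M = plane x A B" "x \<in> V"
    using planes_base assms(1,2) by blast
  then consider "y = x + A" | "y = x + B" | "y = x + (A + B)" using assms by (auto simp: plane_def)
  then show thesis
  proof cases
    case 1
    then show ?thesis using that[of B] AB by simp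
  next
    case 2
    have "plane x A B = plane x B A" by (auto simp: plane_def ac_simps)
    then show ?thesis using that[of A] AB 2 kap_commute[of A B] by simp
  next
    case 3
    have "plane x A B = plane x (A + B) A" by (auto simp: plane_def ac_simps)
    moreover have "kap (A + B) A = c" using kap_shift[of A B] kap_commute[of "A + B" A] AB by simp
    ultimately show ?thesis using that[of A] AB 3 by simp
  qed
qed

lemma planes_unique:
  assumes "M \<in> planes c" "N \<in> planes c" "x \<noteq> y" "{x, y} \<subseteq> M" "{x, y} \<subseteq> N"
  shows "M = N"
proof -
  obtain B where B: "B \<in> V" "kap (x + y) B = c" "M = plane x (x + y) B" "x \<in> V" "y \<in> V"
    by (rule planes_pair[OF assms(1) _ _ assms(3)]) (use assms(4) in auto)
  obtain C where C: "C \<in> V" "kap (x + y) C = c" "N = plane x (x + y) C"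
    by (rule planes_pair[OF assms(2) _ _ assms(3)]) (use assms(5) in auto)
  have "x + y \<noteq> 0" using assms(3) by (metis add.right_neutral pair_add_self_left)
  then have "C = B \<or> C = x + y + B"
    using kap_eq[of "x + y" B C] B C by simp
  moreover have "plane x (x + y) B = plane x (x + y) (x + y + B)" by (auto simp: plane_def ac_simps)
  ultimately show ?thesis using B C by auto
qed

lemma planes_card:
  assumes "c \<noteq> 0" "M \<in> planes c"
  shows "M \<subseteq> V \<and> card M = 4"
proof -
  obtain P A B where M: "M = plane P A B" and V: "P \<in> V" "A \<in> V" "B \<in> V" and c: "kap A B = c"
    using assms(2) by (auto simp: planes_def)
  have "A \<noteq> 0" "B \<noteq> 0" using c assms(1) kap_commute[of A B] by auto
  moreover have "A \<noteq> B" using c assms(1) kap_shift[of A 0] V by (auto simp: V_def zero_prod_def)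
  ultimately have "A + B \<noteq> 0" by (metis add.right_neutral pair_add_self_left)
  then have "card M = 4" using \<open>A \<noteq> 0\<close> \<open>B \<noteq> 0\<close> \<open>A \<noteq> B\<close>
    by (auto simp: M plane_def card_insert_if)
  then show ?thesis using V by (auto simp: M plane_def)
qed

lemma card_planes:
  assumes "c \<noteq> 0"
  shows "12 * card (planes c) \<le> card V * (card V - 1)"
proof -
  have "card (planes c) * (4 * (4 - 1)) \<le> card {(x, y). x \<in> V \<and> y \<in> V \<and> x \<noteq> y \<and> (\<exists>B\<in>planes c. {x, y} \<subseteq> B)}"
    by (rule packing_bound[OF finite_V planes_card[OF assms] planes_unique])
  also have "\<dots> \<le> card V * (card V - 1)" by (rule card_pairs_le[OF finite_V])
  finally show ?thesis by simp
qed

lemma planes_pair_cover: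
  assumes "c \<in> S" "x \<in> V" "y \<in> V" "x \<noteq> y"
  shows "\<exists>M\<in>planes c. {x, y} \<subseteq> M"
proof -
  have "x + y \<noteq> 0" using assms(4) by (metis add.right_neutral pair_add_self_left)
  then have "c \<in> kap (x + y) ` V" using kap_surj[of "x + y"] assms by simp
  then obtain B where "B \<in> V" "kap (x + y) B = c" by blast
  then have "plane x (x + y) B \<in> planes c" using planesI[of x "x + y" B] assms by simp
  then show ?thesis by (rule bexI[rotated]) (simp add: plane_def)
qed

lemma planes_triple_cover:
  assumes "x \<in> V" "y \<in> V" "z \<in> V" "x \<noteq> y" "x \<noteq> z" "y \<noteq> z"
  shows "\<exists>c\<in>S - {0}. \<exists>M\<in>planes c. {x, y, z} \<subseteq> M"
proof -
  let ?A = "x + y" and ?B = "x + z"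
  have A: "?A \<noteq> 0" and B: "?B \<noteq> 0" using assms(4,5) by (metis add.right_neutral pair_add_self_left)+
  have "?A \<noteq> ?B" using assms(6) by simp
  \<comment> \<open>The direction 0 has colour 0, so by \<open>kap_eq\<close> only 0 and
    \<open>?A\<close> have it, and distinct points exclude both.\<close>
  have "kap ?A ?B \<noteq> 0"
  proof
    assume "kap ?A ?B = 0"
    then have "?B = 0 \<or> ?B = ?A + 0"
      using A assms by (intro kap_eq) (auto simp: V_def zero_prod_def)
    then show False using B \<open>?A \<noteq> ?B\<close> by simp
  qed
  moreover have "kap ?A ?B \<in> S" using assms by (simp add: kap_in)
  moreover have "plane x ?A ?B \<in> planes (kap ?A ?B)" using assms by (intro planesI) simp_all
  moreover have "{x, y, z} \<subseteq> plane x ?A ?B" by (auto simp: plane_def)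
  ultimately show ?thesis by blast
qed

lemma planes_resolved: "resolved V (S - {0}) planes"
  unfolding resolved_def
proof (intro conjI ballI impI)
  fix c assume c: "c \<in> S - {0}"
  show "planes c \<subseteq> quads V"
  proof
    fix M assume "M \<in> planes c"
    then have "M \<subseteq> V" "card M = 4" using planes_card[of c M] c by auto
    then show "M \<in> quads V" using finite_subset[OF _ finite_V] by (simp add: quads_def)
  qed
  fix x y assume "x \<in> V" "y \<in> V" "x \<noteq> y"
  then show "\<exists>M\<in>planes c. {x, y} \<subseteq> M" using planes_pair_cover[of c x y] c by blast
next
  fix x y z assume "x \<in> V" "y \<in> V" "z \<in> V" "x \<noteq> y \<and> x \<noteq> z \<and> y \<noteq> z"
  then show "\<exists>c\<in>S - {0}. \<exists>M\<in>planes c. {x, y, z} \<subseteq> M" by (intro planes_triple_cover) auto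
qed

lemma cubes_surj: "(\<lambda>s. s ^ 3) ` (S - {0}) = S - {0}"
proof (rule endo_inj_surj)
  show "inj_on (\<lambda>s. s ^ 3) (S - {0})"
    by (rule inj_onI) (use cube_eq in blast)
qed auto

text \<open>By \<open>cubes_surj\<close> the colour s^3 may be renamed s. Then colour s owns the
  block above 0 and s, as the gluing requires.\<close>

lemma vertical_plane:
  assumes "s \<in> S"
  shows "{0, s} \<times> {0, 1} \<in> planes (s ^ 3)"
proof -
  have "{0, s} \<times> {0, 1} = plane (0, 0) (s, 0) (0, 1)" by (auto simp: plane_def)
  moreover have "kap (s, 0) (0, 1) = s ^ 3" by simp
  moreover have "(0, 0) \<in> V" "(s, 0) \<in> V" "(0, 1) \<in> V" using assms by (auto simp: V_def)
  ultimately show ?thesis using planesI[of "(0, 0)" "(s, 0)" "(0, 1)"] by (simp del: kap.simps)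
qed

end

section \<open>Quadruples on a doubled projective line\<close>

lemma of_nat_CARD_eq_0: "of_nat CARD('k::{finite,comm_ring_1}) = (0 :: 'k)"
proof -
  \<comment> \<open>Translation by 1 permutes the ring, so the sum of all elements does not change
    when 1 is added to each.\<close>
  have "(\<Sum>x\<in>(UNIV::'k set). x + 1) = (\<Sum>x\<in>UNIV. x)"
    by (rule sum.reindex_bij_witness[of _ "\<lambda>x. x - 1" "\<lambda>x. x + 1"]) auto
  then show ?thesis by (simp add: sum.distrib)
qed

definition squares :: "'k::field set" where "squares = {x ^ 2 | x. x \<noteq> 0}"

lemma squares_nonzero: "a \<in> squares \<Longrightarrow> a \<noteq> 0" by (auto simp: squares_def)

lemma squares_mult: "a \<in> squares \<Longrightarrow> b \<in> squares \<Longrightarrow> a * b \<in> squares"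
proof -
  assume "a \<in> squares" "b \<in> squares"
  then obtain x y where "a = x ^ 2" "b = y ^ 2" "x \<noteq> 0" "y \<noteq> 0" by (auto simp: squares_def)
  then have "a * b = (x * y) ^ 2 \<and> x * y \<noteq> 0" by (simp add: power_mult_distrib)
  then show ?thesis unfolding squares_def by blast
qed

lemma squares_divide: "a \<in> squares \<Longrightarrow> 1 / a \<in> squares"
proof -
  assume "a \<in> squares"
  then obtain x where "a = x ^ 2" "x \<noteq> 0" by (auto simp: squares_def)
  then have "1 / a = (1 / x) ^ 2 \<and> 1 / x \<noteq> 0" by (simp add: power_divide)
  then show ?thesis unfolding squares_def by blast
qed

lemma squares_power2: "x \<noteq> 0 \<Longrightarrow> x ^ 2 \<in> squares" by (auto simp: squares_def)

text \<open>Order 3 modulo 4 makes squares pick exactly one of x and -x; order 1 modulo 3 provides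
  primitive cube roots of unity.\<close>

locale field_7_mod_12 =
  fixes dummy :: "'k::finite_field itself"
  assumes card12: "CARD('k) mod 12 = 7"
begin

lemma two_neq_0: "(2::'k) \<noteq> 0"
proof
  assume 2: "(2::'k) = 0"
  have "CARD('k) = 2 * (CARD('k) div 2) + 1" using card12 by presburger
  then have "of_nat CARD('k) = (of_nat (2 * (CARD('k) div 2) + 1) :: 'k)" by simp
  then show False using of_nat_CARD_eq_0[where 'k='k] 2 by simp
qed

text \<open>If i^2 = -1 and q = 4 t + 3, then i = i^q = -i, which is impossible in odd
  characteristic.\<close>

lemma minus_one_not_square: "(-1::'k) \<notin> squares"
proof
  assume "(-1::'k) \<in> squares"
  then obtain i :: 'k where i: "i ^ 2 = -1" "i \<noteq> 0" by (auto simp: squares_def)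
  define t where "t = CARD('k) div 4"
  have t: "CARD('k) = 2 * (2 * t + 1) + 1" using card12 unfolding t_def by presburger
  have "i = i ^ (2 * (2 * t + 1) + 1)" using finite_field_power_card_eq_same[of i] t by simp
  also have "\<dots> = (i ^ 2) ^ (2 * t + 1) * i" by (simp only: power_mult power_add power_one_right)
  also have "\<dots> = - i" by (simp add: i(1) power_mult)
  finally have "2 * i = 0" by (metis add.right_inverse mult_2)
  then show False using i two_neq_0 by simp
qed

lemma squares_minus: "(a::'k) \<in> squares \<Longrightarrow> - a \<notin> squares"
  using minus_one_not_square squares_mult[of "-a" "1 / a"] squares_divide[of a] squares_nonzero[of a] by auto

text \<open>Squaring is at most two-to-one, so at least half of the nonzero elements are squares.
  The squares and their negatives are disjoint, so at most half are, and the two sets exhaust the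
  nonzero elements.\<close>

lemma card_squares: "2 * card (squares :: 'k set) = CARD('k) - 1"
  and square_or_minus: "(x::'k) \<noteq> 0 \<Longrightarrow> x \<in> squares \<or> - x \<in> squares"
proof -
  have c: "card (UNIV - {0::'k}) = CARD('k) - 1" by simp
  have UN: "UNIV - {0::'k} = (\<Union>t\<in>squares. {x. x \<noteq> 0 \<and> x ^ 2 = t})" by (auto simp: squares_def)
  have "card (UNIV - {0::'k}) \<le> (\<Sum>t\<in>(squares::'k set). card {x. x \<noteq> 0 \<and> x ^ 2 = t})"
    unfolding UN by (rule card_UN_le) simp
  also have "\<dots> \<le> of_nat (card (squares :: 'k set)) * 2"
  proof (rule sum_bounded_above)
    fix t :: 'k assume "t \<in> squares"
    then obtain y where y: "t = y ^ 2" by (auto simp: squares_def)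
    have "{x. x \<noteq> 0 \<and> x ^ 2 = t} \<subseteq> {y, - y}" by (auto simp: y power2_eq_iff)
    then have "card {x. x \<noteq> 0 \<and> x ^ 2 = t} \<le> card {y, - y}" by (intro card_mono) auto
    then show "card {x. x \<noteq> 0 \<and> x ^ 2 = t} \<le> 2" by (rule order_trans) (simp add: card_insert_if)
  qed
  finally have ge: "CARD('k) - 1 \<le> card (squares :: 'k set) * 2" using c by simp
  have inj: "card (uminus ` (squares :: 'k set)) = card (squares :: 'k set)"
    by (intro card_image inj_onI) simp
  have disj: "(squares :: 'k set) \<inter> uminus ` squares = {}" using squares_minus by auto
  have sub: "(squares :: 'k set) \<union> uminus ` squares \<subseteq> UNIV - {0}" using squares_nonzero by auto
  have un: "card ((squares :: 'k set) \<union> uminus ` squares) = 2 * card (squares :: 'k set)"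
    using card_Un_disjoint[OF _ _ disj] inj by simp
  then have le: "2 * card (squares :: 'k set) \<le> CARD('k) - 1"
    using card_mono[OF _ sub] c by simp
  then show *: "2 * card (squares :: 'k set) = CARD('k) - 1" using ge by simp
  have "(squares :: 'k set) \<union> uminus ` squares = UNIV - {0}"
    by (rule card_subset_eq[OF _ sub]) (use un * c in auto)
  then show "x \<in> squares \<or> - x \<in> squares" if "x \<noteq> 0" using that
    by (metis (no_types, lifting) Diff_iff UNIV_I UnE empty_iff imageE insert_iff minus_minus)
qed

text \<open>With s = (q - 1) / 3, the polynomial X^s - 1 has too few roots to vanish on all nonzero
  elements; the s-th power of a non-root is a nontrivial cube root of unity.\<close>

lemma ex_primitive_cube_root: "\<exists>w::'k. w ^ 2 + w + 1 = 0 \<and> w \<noteq> 1"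
proof -
  define s where "s = CARD('k) div 3"
  have s: "CARD('k) = 3 * s + 1" "s > 0" using card12 unfolding s_def by presburger+
  let ?f = "monom 1 s - (1 :: 'k poly)"
  have deg: "degree ?f \<le> s" by (rule order_trans[OF degree_diff_le_max]) (simp add: degree_monom_le)
  have f0: "?f \<noteq> 0" using s by (metis degree_1 degree_monom_eq eq_iff_diff_eq_0 less_irrefl one_neq_zero)
  have "\<exists>a::'k. a \<noteq> 0 \<and> a ^ s \<noteq> 1"
  proof (rule ccontr)
    assume "\<not> ?thesis"
    then have "UNIV - {0::'k} \<subseteq> {x. poly ?f x = 0}" by (auto simp: poly_monom)
    then have "card (UNIV - {0::'k}) \<le> card {x. poly ?f x = 0}" by (intro card_mono) auto
    also have "\<dots> \<le> s" using card_poly_roots_bound[OF f0] deg by simp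
    finally show False using s by simp
  qed
  then obtain a :: 'k where a: "a \<noteq> 0" "a ^ s \<noteq> 1" by blast
  define w where "w = a ^ s"
  have "a * a ^ (3 * s) = a" using finite_field_power_card_eq_same[of a] s by simp
  then have "w ^ 3 = 1" using a by (simp add: w_def power_mult mult.commute flip: power_mult)
  then have "(w - 1) * (w ^ 2 + w + 1) = 0" by (simp add: algebra_simps power2_eq_square power3_eq_cube)
  then show ?thesis using a by (auto simp: w_def)
qed

end

section \<open>Quadruples formed by a triple and one of its two Hessian points\<close>

locale hessian_design = field_7_mod_12 dummy for dummy :: "'k::finite_field itself" +
  fixes w :: 'k
  assumes w: "w ^ 2 + w + 1 = 0" "w \<noteq> 1"
begin

lemma w3: "w ^ 3 = 1"
proof -
  have "w ^ 3 - 1 = (w - 1) * (w ^ 2 + w + 1)" by (simp add: algebra_simps power2_eq_square power3_eq_cube)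
  then show ?thesis using w by simp
qed

text \<open>Hence a, a w and a w^2 are squares together, and they describe the same block.\<close>

lemma w_square: "w \<in> squares"
proof -
  have "w \<noteq> 0" using w3 by auto
  moreover have "w = (w ^ 2) ^ 2" using w3 by (simp add: power2_eq_square power3_eq_cube mult.assoc)
  ultimately show ?thesis using squares_power2[of "w ^ 2"] by simp
qed

text \<open>On the projective line over \<open>'k\<close>, the points \<open>e\<close> and \<open>\<infinity>\<close> (encoded by \<^const>\<open>None\<close>) are the fixed
  points of the projectivity of order 3 that permutes \<open>e + a\<close>, \<open>e + a w\<close>, \<open>e + a w\<^sup>2\<close> cyclically. Admitting
  only squares \<open>a\<close> decides which of the two joins the triple in a block, the other one being the
  colour of the block.\<close>

definition blk :: "'k \<Rightarrow> 'k \<Rightarrow> bool \<Rightarrow> ('k option \<times> bool) set" where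
  "blk e a l = {(Some e, \<not> l), (Some (e + a), l), (Some (e + a * w), l), (Some (e + a * w ^ 2), l)}"

definition E0 :: "('k option \<times> bool) set set" where
  "E0 = {blk e a l | e a l. a \<in> squares}"

lemma blkI: "a \<in> squares \<Longrightarrow> blk e a l \<in> E0" by (auto simp: E0_def)

text \<open>On one level the difference of the points prescribes a up to sign, on different levels
  it is a up to sign, and the sign is the choice of the roles of the two points. One of the two
  signs gives a square.\<close>

lemma E0_pair_cover:
  assumes "x \<noteq> y"
  shows "\<exists>B\<in>E0. {(Some x, i), (Some y, j)} \<subseteq> B"
proof (cases "i = j")
  case True
  have *: "\<exists>B\<in>E0. {(Some x, i), (Some y, i)} \<subseteq> B" if "(y - x) / (1 - w) \<in> squares" for x y
  proof -
    define a where "a = (y - x) / (1 - w)"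
    have "y - x = a * (1 - w)" using w by (simp add: a_def)
    then have "x = (y - a) + a * w" "y = (y - a) + a" by (simp_all add: algebra_simps)
    then have "{(Some x, i), (Some y, i)} \<subseteq> blk (y - a) a i" unfolding blk_def by blast
    then show ?thesis using blkI that a_def by blast
  qed
  have "(y - x) / (1 - w) \<noteq> 0" using assms w by simp
  then have "(y - x) / (1 - w) \<in> squares \<or> (x - y) / (1 - w) \<in> squares"
    using square_or_minus[of "(y - x) / (1 - w)"] by (simp add: minus_divide_left)
  then show ?thesis using *[of y x] *[of x y] True by (auto simp: insert_commute)
next
  case False
  have *: "\<exists>B\<in>E0. {(Some x, i), (Some y, j)} \<subseteq> B" if "y - x \<in> squares" "i \<noteq> j" for x y i j
  proof -
    have "{(Some x, i), (Some y, j)} \<subseteq> blk x (y - x) j" using that by (auto simp: blk_def)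
    then show ?thesis using blkI that by blast
  qed
  have "y - x \<in> squares \<or> x - y \<in> squares" using square_or_minus[of "y - x"] assms by simp
  then show ?thesis using *[of y x i j] *[of x y j i] *[of y x j i] *[of x y i j] False by (auto simp: insert_commute)
qed

text \<open>There are q choices of e, two levels and (q - 1) / 6 orbits of squares under
  multiplication by \<open>w\<close>; each orbit gives one block.\<close>

lemma card_E0: "3 * card E0 \<le> CARD('k) * (CARD('k) - 1)"
proof -
  define orb where "orb = (\<lambda>a. {a, a * w, a * w ^ 2})"
  define O3 where "O3 = orb ` squares"
  have orb_step: "orb (a * w) = orb a" for a
  proof -
    have "a * w * w = a * w ^ 2" "a * w * w ^ 2 = a * w ^ 3"
      by (simp_all only: power2_eq_square power3_eq_cube mult.assoc)
    then have "a * w * w = a * w ^ 2" "a * w * w ^ 2 = a" using w3 by simp_all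
    then show ?thesis unfolding orb_def by auto
  qed
  have orb_step2: "orb (a * w ^ 2) = orb a" for a
    using orb_step[of "a * w"] orb_step[of a] by (simp only: power2_eq_square mult.assoc)
  have orb_mem: "orb b = orb a" if "b \<in> orb a" for a b
  proof -
    have "b = a \<or> b = a * w \<or> b = a * w ^ 2" using that by (simp add: orb_def)
    then show ?thesis using orb_step[of a] orb_step2[of a] by metis
  qed
  have wn: "w \<noteq> 0" "w ^ 2 \<noteq> 1" "w ^ 2 \<noteq> w"
    using w3 w by (auto simp: power2_eq_square power3_eq_cube)
  have c3: "card (orb a) = 3" if "a \<in> squares" for a
    using wn w squares_nonzero[OF that] by (simp add: orb_def card_insert_if)
  have "card A = 3" if "A \<in> O3" for A using c3 that by (auto simp: O3_def)
  then have "3 * card O3 = (\<Sum>A\<in>O3. card A)" by simp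
  also have "\<dots> = card (\<Union>O3)"
  proof (rule card_Union_disjoint[symmetric])
    show "pairwise disjnt O3"
    proof (rule pairwiseI)
      fix A B assume "A \<in> O3" "B \<in> O3" "A \<noteq> B"
      then obtain a b where ab: "A = orb a" "B = orb b" "orb a \<noteq> orb b" by (auto simp: O3_def)
      then show "disjnt A B" using orb_mem unfolding disjnt_def by blast
    qed
  qed auto
  also have "\<dots> \<le> card (squares :: 'k set)"
    using squares_mult w_square squares_mult[OF w_square w_square]
    by (intro card_mono) (auto simp: O3_def orb_def power2_eq_square)
  finally have O3: "3 * card O3 \<le> card (squares :: 'k set)" .
  define mk where "mk = (\<lambda>(e :: 'k, A, l). insert (Some e, \<not> l) ((\<lambda>a. (Some (e + a), l)) ` A))"
  have "E0 \<subseteq> mk ` ((UNIV :: 'k set) \<times> O3 \<times> (UNIV :: bool set))"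
  proof
    fix B assume "B \<in> E0"
    then obtain e a l where B: "B = blk e a l" "a \<in> squares" by (auto simp: E0_def)
    then have "B = mk (e, orb a, l)" by (auto simp: mk_def orb_def blk_def)
    moreover have "orb a \<in> O3" using B by (simp add: O3_def)
    ultimately show "B \<in> mk ` (UNIV \<times> O3 \<times> UNIV)" by blast
  qed
  then have "card E0 \<le> card (mk ` ((UNIV :: 'k set) \<times> O3 \<times> (UNIV :: bool set)))"
    by (intro card_mono) (auto simp: O3_def)
  also have "\<dots> \<le> card ((UNIV :: 'k set) \<times> O3 \<times> (UNIV :: bool set))"
    by (intro card_image_le) (auto simp: O3_def)
  also have "\<dots> = CARD('k) * (2 * card O3)" by (simp add: card_cartesian_product)
  finally have "3 * card E0 \<le> CARD('k) * (2 * (3 * card O3))" by simp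
  also have "\<dots> \<le> CARD('k) * (2 * card (squares :: 'k set))" using O3 by (intro mult_left_mono) auto
  also have "\<dots> = CARD('k) * (CARD('k) - 1)" by (simp only: card_squares)
  finally show ?thesis .
qed

section \<open>The action of PSL(2, q) on coloured quadruples\<close>

definition trans :: "'k \<Rightarrow> 'k option \<Rightarrow> 'k option" where "trans b = map_option (\<lambda>x. x + b)"
definition scale :: "'k \<Rightarrow> 'k option \<Rightarrow> 'k option" where "scale s = map_option (\<lambda>x. s * x)"
text \<open>The sign gives determinant 1. The map 1 / x has determinant -1, a nonsquare, and would
  leave PSL(2, q).\<close>

definition invert :: "'k option \<Rightarrow> 'k option" where
  "invert x = (case x of None \<Rightarrow> Some 0 | Some a \<Rightarrow> if a = 0 then None else Some (- 1 / a))"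

abbreviation lift :: "('k option \<Rightarrow> 'k option) \<Rightarrow> ('k option \<times> bool) set \<Rightarrow> ('k option \<times> bool) set" where
  "lift f B \<equiv> apfst f ` B"

text \<open>\<open>trans a \<circ> invert\<close> is one projectivity of PSL(2, q) that carries
  infinity to a; the class of colour infinity is moved along it.\<close>

definition Ec :: "'k option \<Rightarrow> ('k option \<times> bool) set set" where
  "Ec c = (case c of None \<Rightarrow> E0 | Some a \<Rightarrow> lift (trans a \<circ> invert) ` E0)"

lemma trans_trans: "trans a (trans b x) = trans (b + a) x" "trans 0 x = x"
  by (cases x; simp add: trans_def add.assoc)+
lemma scale_scale: "s * t = 1 \<Longrightarrow> scale s (scale t x) = x"
  by (cases x) (simp_all add: scale_def flip: mult.assoc)
lemma special_values [simp]: "invert None = Some 0" "invert (Some 0) = None" "trans b None = None" "scale s None = None"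
  by (simp_all add: invert_def trans_def scale_def)
lemma invert_invert [simp]: "invert (invert x) = x"
  by (cases x) (auto simp: invert_def)

lemma lift_E0:
  assumes "B \<in> E0" shows "lift (trans b) B \<in> E0" "s \<in> squares \<Longrightarrow> lift (scale s) B \<in> E0"
proof -
  obtain e a l where B: "B = blk e a l" "a \<in> squares" using assms by (auto simp: E0_def)
  have "lift (trans b) B = blk (e + b) a l" by (auto simp: B blk_def trans_def algebra_simps)
  then show "lift (trans b) B \<in> E0" using B blkI by simp
  have "lift (scale s) B = blk (s * e) (s * a) l" by (auto simp: B blk_def scale_def algebra_simps)
  then show "s \<in> squares \<Longrightarrow> lift (scale s) B \<in> E0" using B by (simp add: blkI squares_mult)
qed

lemma lift_comp: "lift f (lift g B) = lift (f \<circ> g) B"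
  by (simp add: image_image apfst_compose comp_def)

text \<open>With \<open>Ec_scale\<close> and \<open>Ec_invert\<close> this is equivariance: moving a
  block moves its colour. It rests on \<open>lift_E0\<close>, the invariance of \<open>E0\<close>
  under the stabiliser of infinity, the maps s x + b with s a square.\<close>

lemma Ec_trans: assumes "B \<in> Ec c" shows "lift (trans b) B \<in> Ec (trans b c)"
proof (cases c)
  case None
  have B: "B \<in> E0" using assms(1) by (simp add: Ec_def None)
  have c: "trans b c = None" by (simp add: None trans_def)
  show ?thesis unfolding c using lift_E0(1)[OF B] by (simp add: Ec_def)
next
  case (Some a)
  then obtain A where A: "A \<in> E0" "B = lift (trans a \<circ> invert) A" using assms by (auto simp: Ec_def)
  have "trans b \<circ> (trans a \<circ> invert) = trans (a + b) \<circ> invert" by (auto simp: trans_trans)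
  then have "lift (trans b) B = lift (trans (a + b) \<circ> invert) A" using A lift_comp by metis
  then show ?thesis using A Some by (auto simp: Ec_def trans_def)
qed

lemma Ec_scale: assumes "B \<in> Ec c" "s \<in> squares" shows "lift (scale s) B \<in> Ec (scale s c)"
proof (cases c)
  case None
  have B: "B \<in> E0" using assms(1) by (simp add: Ec_def None)
  have c: "scale s c = None" by (simp add: None scale_def)
  show ?thesis unfolding c using lift_E0(2)[OF B assms(2)] by (simp add: Ec_def)
next
  case (Some a)
  then obtain A where A: "A \<in> E0" "B = lift (trans a \<circ> invert) A" using assms by (auto simp: Ec_def)
  \<comment> \<open>Because s (a - 1 / y) = s a - 1 / (y / s), the scaling moves to the innermost
    place, where it preserves \<open>E0\<close>.\<close>
  have "scale s \<circ> (trans a \<circ> invert) = trans (s * a) \<circ> invert \<circ> scale (1 / s)"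
  proof
    fix x show "(scale s \<circ> (trans a \<circ> invert)) x = (trans (s * a) \<circ> invert \<circ> scale (1 / s)) x"
    proof (cases x)
      case (Some y)
      have "s \<noteq> 0" using squares_nonzero[OF assms(2)] .
      then show ?thesis
        by (cases "y = 0") (simp_all add: Some scale_def trans_def invert_def algebra_simps)
    qed (simp add: scale_def trans_def invert_def)
  qed
  then have "lift (scale s) B = lift (trans (s * a) \<circ> invert) (lift (scale (1 / s)) A)"
    using A lift_comp by metis
  moreover have "lift (scale (1 / s)) A \<in> E0" by (rule lift_E0(2)[OF A(1) squares_divide[OF assms(2)]])
  ultimately show ?thesis using Some by (simp add: Ec_def scale_def)
qed

lemma Ec_invert: assumes "B \<in> Ec c" shows "lift invert B \<in> Ec (invert c)"
proof (cases c)
  case None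
  have "trans 0 \<circ> invert = invert" by (auto simp: trans_trans)
  then show ?thesis using assms None by (simp add: Ec_def invert_def[of None])
next
  case (Some a)
  then obtain A where A: "A \<in> E0" "B = lift (trans a \<circ> invert) A" using assms by (auto simp: Ec_def)
  show ?thesis
  proof (cases "a = 0")
    case True
    have "invert \<circ> (trans 0 \<circ> invert) = id" by (auto simp: trans_trans)
    then have "lift invert B = A" using A True lift_comp[of invert "trans 0 \<circ> invert"] by simp
    then show ?thesis using A Some True by (simp add: Ec_def invert_def)
  next
    case False
    \<comment> \<open>This is -1 / (a - 1 / y) = -1 / a - 1 / (a^2 y - a). The innermost map a^2 y -
      a fixes infinity and has a square factor, so it preserves \<open>E0\<close>.\<close>
    have "invert \<circ> (trans a \<circ> invert) = trans (- 1 / a) \<circ> invert \<circ> (trans (- a) \<circ> scale (a ^ 2))"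
    proof
      fix x show "(invert \<circ> (trans a \<circ> invert)) x = (trans (- 1 / a) \<circ> invert \<circ> (trans (- a) \<circ> scale (a ^ 2))) x"
      proof (cases x)
        case (Some y)
        show ?thesis
        \<comment> \<open>For these y an inversion on the left-hand side yields the point at
          infinity.\<close>
        proof (cases "y = 0 \<or> a * y = 1")
          case True
          then show ?thesis
          proof
            assume "y = 0"
            then show ?thesis using False by (simp add: Some scale_def trans_def invert_def)
          next
            assume ay: "a * y = 1"
            then have y: "y \<noteq> 0" by auto
            have "1 / y = a" using ay y by (simp add: divide_eq_eq)
            then have "trans a (invert x) = Some 0" using y by (simp add: Some trans_def invert_def)
            moreover have "trans (- a) (scale (a ^ 2) x) = Some 0"
              using ay by (simp add: Some trans_def scale_def power2_eq_square mult.assoc)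
            ultimately show ?thesis by simp
          qed
        next
          case y: False
          define d where "d = a * y - 1"
          have d: "d \<noteq> 0" "y \<noteq> 0" using y by (auto simp: d_def)
          have e: "a - 1 / y = d / y" "a ^ 2 * y - a = a * d"
            using d(2) by (simp_all add: d_def diff_divide_distrib power2_eq_square right_diff_distrib mult.assoc)
          have "- 1 / (a * d) - 1 / a = (- 1 - d) / (a * d)"
            using d False by (simp add: diff_divide_distrib)
          also have "\<dots> = - (a * y) / (a * d)" by (simp add: d_def)
          also have "\<dots> = - 1 / (d / y)" using False by simp
          finally have "- 1 / (d / y) = - 1 / (a * d) - 1 / a" ..
          moreover have "d / y \<noteq> 0" "a * d \<noteq> 0" using d False by simp_all
          moreover have "invert (trans a (invert x)) = Some (- 1 / (d / y))"
            using d e(1) by (simp add: Some trans_def invert_def)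
          moreover have "trans (- 1 / a) (invert (trans (- a) (scale (a ^ 2) x))) = Some (- 1 / (a * d) - 1 / a)"
            using d False e(2) by (simp add: Some trans_def invert_def scale_def)
          ultimately show ?thesis by simp
        qed
      qed (use False in \<open>simp add: scale_def trans_def invert_def\<close>)
    qed
    then have "lift invert B = lift (trans (- 1 / a) \<circ> invert) (lift (trans (- a)) (lift (scale (a ^ 2)) A))"
      using A lift_comp by metis
    moreover have "lift (trans (- a)) (lift (scale (a ^ 2)) A) \<in> E0"
      by (intro lift_E0(1) lift_E0(2)[OF A(1) squares_power2[OF False]])
    ultimately show ?thesis using Some False by (simp add: Ec_def invert_def)
  qed
qed

text \<open>The maps above generate \<open>PSL(2, q)\<close>. Since \<open>-1\<close> is not a square, this group has two orbits on
  ordered triples, exchanged by odd permutations.\<close>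

lemma triple_transitive:
  fixes P :: "'k option \<Rightarrow> 'k option \<Rightarrow> 'k option \<Rightarrow> bool"
  assumes tr: "\<And>b x y z. P x y z \<Longrightarrow> P (trans b x) (trans b y) (trans b z)"
    and sc: "\<And>s x y z. s \<in> squares \<Longrightarrow> P x y z \<Longrightarrow> P (scale s x) (scale s y) (scale s z)"
    and inv: "\<And>x y z. P x y z \<Longrightarrow> P (invert x) (invert y) (invert z)"
    and sym: "\<And>x y z. P x y z \<Longrightarrow> P x z y"
    and P: "P x0 y0 z0" "distinct [x0, y0, z0]" and xyz: "distinct [x, y, z]"
  shows "P x y z"
proof -
  have tr': "P (trans b x) (trans b y) (trans b z) \<longleftrightarrow> P x y z" for b x y z
    using tr[of x y z b] tr[of "trans b x" "trans b y" "trans b z" "- b"] by (auto simp: trans_trans)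
  have sc': "P (scale s x) (scale s y) (scale s z) \<longleftrightarrow> P x y z" if "s \<in> squares" for s x y z
    using sc[OF that, of x y z] sc[OF squares_divide[OF that], of "scale s x" "scale s y" "scale s z"]
      squares_nonzero[OF that] by (auto simp: scale_scale)
  have inv': "P (invert x) (invert y) (invert z) \<longleftrightarrow> P x y z" for x y z
    using inv[of x y z] inv[of "invert x" "invert y" "invert z"] by auto
  have sym': "P x y z \<longleftrightarrow> P x z y" for x y z using sym by blast
  have std: "P x y z \<longleftrightarrow> P None (Some 0) (Some 1)" if "distinct [x, y, z]" for x y z
  proof -
    \<comment> \<open>Translation by -1 followed by the exchange of the last two points joins the
      two orbits of ordered triples.\<close>
    have pm: "P None (Some 0) (Some (- 1)) \<longleftrightarrow> P None (Some 0) (Some 1)"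
      using tr'[of "-1" None "Some 1" "Some 0"] sym'[of None "Some 1" "Some 0"] by (simp add: trans_def)
    have c: "P None (Some 0) (Some d) \<longleftrightarrow> P None (Some 0) (Some 1)" if "d \<noteq> 0" for d
      using square_or_minus[OF that]
    proof
      assume "d \<in> squares"
      from sc'[OF this, of None "Some 0" "Some 1"] show ?thesis by (simp add: scale_def)
    next
      assume "- d \<in> squares"
      from sc'[OF this, of None "Some 0" "Some (- 1)"] show ?thesis using pm by (simp add: scale_def)
    qed
    have b: "P None y z \<longleftrightarrow> P None (Some 0) (Some 1)" if yz: "distinct [None, y, z]" for y z
    proof -
      obtain e d where "y = Some e" "z = Some d" "e \<noteq> d"
        using yz by (cases y; cases z) auto
      then show ?thesis using tr'[of "- e" None y z] c[of "d - e"] by (simp add: trans_def)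
    qed
    show ?thesis
    proof (cases x)
      case None
      then show ?thesis using b[of y z] that by simp
    next
      case (Some a)
      \<comment> \<open>This projectivity sends \<open>x\<close> to infinity and reduces to the case
        just treated.\<close>
      let ?f = "\<lambda>x. invert (trans (- a) x)"
      have f: "trans a (invert (?f x)) = x" for x by (simp add: trans_trans)
      have x: "?f x = None" by (simp add: Some trans_def)
      have "?f y \<noteq> ?f z" "?f y \<noteq> ?f x" "?f z \<noteq> ?f x"
        using f that by (metis distinct_length_2_or_more)+
      then have d: "distinct [None, ?f y, ?f z]" unfolding x by (simp add: eq_commute)
      have "P (?f x) (?f y) (?f z) \<longleftrightarrow> P None (Some 0) (Some 1)" unfolding x by (rule b[OF d])
      then show ?thesis by (simp only: inv' tr')
    qed
  qed
  show ?thesis by (rule iffD2[OF std[OF xyz] iffD1[OF std[OF P(2)] P(1)]])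
qed

text \<open>Coverage is invariant under PSL(2, q) and, as the last two points share a level, under
  their exchange. By \<open>triple_transitive\<close> one covered triple per level pattern is
  enough, and \<open>blk 0 1 j\<close> supplies it.\<close>

lemma Ec_triple_cover_aux:
  defines "cov \<equiv> \<lambda>i j x y z. \<exists>c. \<exists>B\<in>Ec c. {(x, i), (y, j), (z, j)} \<subseteq> B"
  assumes "distinct [x, y, z]"
  shows "cov i j x y z"
proof -
  have mono: "{(f x, i), (f y, j), (f z, j)} \<subseteq> lift f B" if "{(x, i), (y, j), (z, j)} \<subseteq> B" for f x y z B
    using that by (auto simp: image_iff apfst_def map_prod_def) force+
  have w0: "w \<noteq> 0" "w \<noteq> 1" "w ^ 2 \<noteq> w" "w ^ 2 \<noteq> 1"
    using w3 w by (auto simp: power2_eq_square power3_eq_cube)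
  have B: "blk 0 1 j \<in> Ec None" using blkI[of 1 0 j] squares_power2[of 1] by (simp add: Ec_def)
  have ex: "\<exists>x0 y0 z0. cov i j x0 y0 z0 \<and> distinct [x0, y0, z0]"
  proof (cases "i = j")
    case True
    then have "{(Some 1, i), (Some w, j), (Some (w ^ 2), j)} \<subseteq> blk 0 1 j" by (auto simp: blk_def)
    then have "cov i j (Some 1) (Some w) (Some (w ^ 2))" unfolding cov_def using B by blast
    then show ?thesis using w0 by (intro exI conjI) auto
  next
    case False
    then have "{(Some 0, i), (Some 1, j), (Some w, j)} \<subseteq> blk 0 1 j" by (auto simp: blk_def)
    then have "cov i j (Some 0) (Some 1) (Some w)" unfolding cov_def using B by blast
    then show ?thesis using w0 by (intro exI conjI) auto
  qed
  show ?thesis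
  proof (rule exE[OF ex], elim exE conjE)
    fix x0 y0 z0 assume 0: "cov i j x0 y0 z0" "distinct [x0, y0, z0]"
    show ?thesis
    proof (rule triple_transitive[where P = "cov i j", OF _ _ _ _ 0 assms(2)])
      show "cov i j (trans b x) (trans b y) (trans b z)" if "cov i j x y z" for b x y z
        using that mono Ec_trans unfolding cov_def by meson
      show "cov i j (scale b x) (scale b y) (scale b z)" if "b \<in> squares" "cov i j x y z" for b x y z
        using that mono Ec_scale unfolding cov_def by meson
      show "cov i j (invert x) (invert y) (invert z)" if "cov i j x y z" for x y z
        using that mono Ec_invert unfolding cov_def by meson
      show "cov i j x z y" if "cov i j x y z" for x y z
        using that unfolding cov_def by (simp add: insert_commute)
    qed
  qed
qed

text \<open>Two of three points lie on the same level and can be taken as the last two.\<close>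

lemma Ec_triple_cover:
  assumes "distinct [x, y, z]"
  shows "\<exists>c. \<exists>B\<in>Ec c. {(x, i), (y, j), (z, k)} \<subseteq> B"
proof -
  consider "j = k" | "i = k" | "i = j" by blast
  then show ?thesis
  proof cases
    case 1
    then show ?thesis using Ec_triple_cover_aux[OF assms] by simp
  next
    case 2
    have "\<exists>c. \<exists>B\<in>Ec c. {(y, j), (x, i), (z, i)} \<subseteq> B"
      by (rule Ec_triple_cover_aux) (use assms in auto)
    then show ?thesis using 2 by (simp add: insert_commute)
  next
    case 3
    have "\<exists>c. \<exists>B\<in>Ec c. {(z, k), (x, i), (y, i)} \<subseteq> B"
      by (rule Ec_triple_cover_aux) (use assms in auto)
    then show ?thesis using 3 by (simp add: insert_commute)
  qed
qed

lemma Ec_quads: "Ec c \<subseteq> quads ((UNIV - {c}) \<times> UNIV)"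
proof
  have blk4: "card (blk e a l) \<le> 4" "finite (blk e a l)" for e a l
    by (simp_all add: blk_def card_insert_if)
  fix B assume B: "B \<in> Ec c"
  show "B \<in> quads ((UNIV - {c}) \<times> UNIV)"
  proof (cases c)
    case None
    then obtain e a l where "B = blk e a l" using B by (auto simp: Ec_def E0_def)
    then show ?thesis using None blk4 by (auto simp: quads_def blk_def)
  next
    case (Some d)
    then obtain e a l where Be: "B = lift (trans d \<circ> invert) (blk e a l)" using B by (auto simp: Ec_def E0_def)
    have "trans d (invert (Some x)) \<noteq> Some d" for x by (auto simp: trans_def invert_def)
    then have "B \<subseteq> (UNIV - {c}) \<times> UNIV" by (auto simp: Be Some blk_def)
    moreover have "card B \<le> card (blk e a l)" unfolding Be by (rule card_image_le) (rule blk4)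
    ultimately show ?thesis using blk4[of e a l] by (auto simp: quads_def Be)
  qed
qed

lemma card_Ec: "3 * card (Ec c) \<le> CARD('k) * (CARD('k) - 1)"
proof -
  have "card (Ec c) \<le> card E0" by (cases c) (auto simp: Ec_def intro: card_image_le)
  then show ?thesis using card_E0 by linarith
qed

lemma Ec_pair_cover:
  assumes "x \<noteq> y" "x \<noteq> c" "y \<noteq> c"
  shows "\<exists>B\<in>Ec c. {(x, i), (y, j)} \<subseteq> B"
proof (cases c)
  case None
  then obtain a b where "x = Some a" "y = Some b" using assms by auto
  then show ?thesis using E0_pair_cover[of a b i j] assms None by (simp add: Ec_def)
next
  case (Some d)
  let ?f = "\<lambda>x. invert (trans (- d) x)"
  have f: "trans d (invert (?f x)) = x" for x by (simp add: trans_trans)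
  have "?f (Some d) = None" by (simp add: trans_def invert_def)
  then have "?f x \<noteq> None" "?f y \<noteq> None" "?f x \<noteq> ?f y" using f assms Some by metis+
  then obtain a b where ab: "?f x = Some a" "?f y = Some b" "a \<noteq> b" by auto
  obtain B where B: "B \<in> E0" "{(Some a, i), (Some b, j)} \<subseteq> B" using E0_pair_cover[OF ab(3)] by blast
  have "apfst (trans d \<circ> invert) (Some a, i) = (x, i)" "apfst (trans d \<circ> invert) (Some b, j) = (y, j)"
    using f[of x] f[of y] ab by simp_all
  then have "{(x, i), (y, j)} \<subseteq> lift (trans d \<circ> invert) B" using B(2) by (metis image_eqI insert_subset empty_subsetI)
  then show ?thesis using B(1) Some by (auto simp: Ec_def)
qed

end

section \<open>Transport to lines and circles\<close>

lemma CHAR_gf2: "CHAR(gf2) = 2"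
proof -
  have "(1::gf2) + 1 = 0" by transfer simp
  then have "of_nat 2 = (0 :: gf2)" by simp
  then have "CHAR(gf2) dvd 2" by (simp only: of_nat_eq_0_iff_char_dvd)
  then show ?thesis by (rule primes_dvd_imp_eq[OF CHAR_prime two_is_prime_nat])
qed

lemma odd_binary_field_gf2:
  assumes "odd k"
  shows "odd_binary_field {x::gf2 alg_closure. x ^ (2 ^ k) = x} k"
proof
  have C: "CHAR(gf2 alg_closure) = 2" by (simp add: CHAR_gf2)
  have p: "prime CHAR(gf2 alg_closure)" by (simp only: C two_is_prime_nat)
  show "subfield_set {x::gf2 alg_closure. x ^ (2 ^ k) = x}"
    using subfield_set_frobenius_fixed[OF p, of k] by (simp only: C)
  show "card {x::gf2 alg_closure. x ^ (2 ^ k) = x} = 2 ^ k"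
    using card_frobenius_fixed[OF p, of k] assms by (simp only: C) (simp add: odd_pos Suc_leI)
  have "of_nat CHAR(gf2 alg_closure) = (0 :: gf2 alg_closure)" by (rule of_nat_CHAR)
  then show "(1 :: gf2 alg_closure) + 1 = 0" by (simp only: C) simp
qed (use assms in auto)

text \<open>Baker's classes carried to a line: \<open>p\<close> will be infinity, it corresponds to
  0 in GF(2^k), and the colours become the other points of the line.\<close>

lemma vertical_design:
  assumes k: "odd k" and C: "finite C" "card C = 2 ^ k" "p \<in> C"
  shows "\<exists>D. resolved (C \<times> (UNIV :: bool set)) (C - {p}) D \<and>
    (\<forall>c\<in>C - {p}. 12 * card (D c) \<le> (2 * card C) * (2 * card C - 1) \<and> {p, c} \<times> UNIV \<in> D c)"
proof -
  let ?S = "{x::gf2 alg_closure. x ^ (2 ^ k) = x}"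
  interpret odd_binary_field ?S k by (rule odd_binary_field_gf2[OF k])
  have "card (?S - {0}) = card (C - {p})" using C cardS by (simp add: card_Diff_singleton)
  then obtain h where h: "bij_betw h (?S - {0}) (C - {p})"
    using finite_same_card_bij[of "?S - {0}" "C - {p}"] C(1) by auto
  define \<phi> where "\<phi> = (\<lambda>x. if x = 0 then p else h x)"
  have \<phi>: "bij_betw \<phi> ?S C"
  proof -
    have "bij_betw \<phi> (?S - {0}) (C - {p})" using h by (subst bij_betw_cong[of _ _ h]) (auto simp: \<phi>_def)
    then have "bij_betw \<phi> ((?S - {0}) \<union> {0}) ((C - {p}) \<union> {p})"
      by (rule bij_betw_combine) (auto simp: \<phi>_def bij_betw_def)
    moreover have "(?S - {0}) \<union> {0} = ?S" using S_closed(1) by blast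
    moreover have "(C - {p}) \<union> {p} = C" using C(3) by blast
    ultimately show ?thesis by simp
  qed
  define f where "f = map_prod \<phi> (\<lambda>l. l = (1 :: gf2 alg_closure))"
  have f: "bij_betw f V (C \<times> (UNIV :: bool set))"
    unfolding f_def V_def
    by (rule bij_betw_map_prod[OF \<phi>]) (auto simp: bij_betw_def inj_on_def)
  define s where "s = inv_into ?S \<phi>"
  have s: "s c \<in> ?S - {0}" "\<phi> (s c) = c" if "c \<in> C - {p}" for c
  proof -
    have "c \<in> \<phi> ` ?S" using \<phi> that by (auto simp: bij_betw_def)
    then show "\<phi> (s c) = c" unfolding s_def by (rule f_inv_into_f)
    moreover have "s c \<in> ?S" unfolding s_def by (rule inv_into_into) fact
    ultimately show "s c \<in> ?S - {0}" using that by (auto simp: \<phi>_def)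
  qed
  have im: "(\<lambda>c. s c ^ 3) ` (C - {p}) = ?S - {0}"
  proof -
    have "s ` (C - {p}) = ?S - {0}"
    proof (intro equalityI subsetI)
      fix x assume x: "x \<in> ?S - {0}"
      then have "\<phi> x \<in> C - {p}" using h by (auto simp: \<phi>_def bij_betw_def)
      moreover have "s (\<phi> x) = x" unfolding s_def using \<phi> x by (intro inv_into_f_f) (auto simp: bij_betw_def)
      ultimately show "x \<in> s ` (C - {p})" by (metis image_eqI)
    qed (use s in auto)
    moreover have "(\<lambda>c. s c ^ 3) ` (C - {p}) = (\<lambda>s. s ^ 3) ` s ` (C - {p})" by (simp only: image_image)
    ultimately show ?thesis by (simp only: cubes_surj)
  qed
  \<comment> \<open>Colour c takes the class of the cube of its field element, so that by
    \<open>vertical_plane\<close> it contains the block above \<open>p\<close> and c.\<close>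
  define D where "D = (\<lambda>c. (`) f ` planes (s c ^ 3))"
  have r: "resolved (C \<times> (UNIV :: bool set)) (C - {p}) D"
    unfolding D_def by (rule resolved_reindex[OF resolved_image[OF planes_resolved f] im])
  have d: "12 * card (D c) \<le> (2 * card C) * (2 * card C - 1) \<and> {p, c} \<times> UNIV \<in> D c"
    if c: "c \<in> C - {p}" for c
  proof
    have sc: "s c ^ 3 \<noteq> 0" using s[OF c] by auto
    have "finite (planes (s c ^ 3))"
      by (rule finite_subset[of _ "Pow V"]) (use planes_card[OF sc] finite_V in auto)
    then have "card (D c) \<le> card (planes (s c ^ 3))" unfolding D_def by (rule card_image_le)
    then have "12 * card (D c) \<le> 12 * card (planes (s c ^ 3))" by simp
    also have "\<dots> \<le> card V * (card V - 1)" by (rule card_planes[OF sc])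
    also have "card V = 2 * card C" by (simp add: card_V C)
    finally show "12 * card (D c) \<le> (2 * card C) * (2 * card C - 1)" .
    have "f ` ({0, s c} \<times> {0, 1}) = {p, c} \<times> UNIV"
      using s(2)[OF c] by (auto simp: f_def \<phi>_def image_iff UNIV_bool)
    then have e: "{p, c} \<times> UNIV = f ` ({0, s c} \<times> {0, 1})" ..
    have "{0, s c} \<times> {0, 1} \<in> planes (s c ^ 3)" using s(1)[OF c] by (intro vertical_plane) simp
    then show "{p, c} \<times> UNIV \<in> D c" unfolding D_def by (rule image_eqI[where f = "(`) f", OF e])
  qed
  show ?thesis by (intro exI[of _ D] conjI ballI r conjunct1[OF d] conjunct2[OF d])
qed

text \<open>Unlike a line, a circle has no distinguished point, and colours are renamed along with
  points, so any bijection with the projective line over the small field serves.\<close>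

lemma circle_design:
  assumes card12: "CARD('k::finite_field) mod 12 = 7" and C: "finite C" "card C = CARD('k) + 1"
  shows "\<exists>E. (\<forall>c\<in>C. E c \<subseteq> quads ((C - {c}) \<times> (UNIV :: bool set)) \<and>
        3 * card (E c) \<le> CARD('k) * (CARD('k) - 1) \<and>
        (\<forall>x\<in>C - {c}. \<forall>y\<in>C - {c}. \<forall>i j. x \<noteq> y \<longrightarrow> (\<exists>B\<in>E c. {(x, i), (y, j)} \<subseteq> B))) \<and>
      (\<forall>x\<in>C. \<forall>y\<in>C. \<forall>z\<in>C. \<forall>i j k. distinct [x, y, z] \<longrightarrow>
        (\<exists>c\<in>C. \<exists>B\<in>E c. {(x, i), (y, j), (z, k)} \<subseteq> B))"
proof -
  interpret f7: field_7_mod_12 "TYPE('k)" by standard (rule card12)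
  obtain w :: 'k where "w ^ 2 + w + 1 = 0" "w \<noteq> 1" using f7.ex_primitive_cube_root by blast
  then interpret hessian_design "TYPE('k)" w by unfold_locales
  have "card (UNIV :: 'k option set) = card C" using C by (simp add: card_UNIV_option)
  then obtain \<psi> where \<psi>: "bij_betw \<psi> (UNIV :: 'k option set) C"
    using finite_same_card_bij[of "UNIV :: 'k option set" C] C(1) by auto
  define \<theta> where "\<theta> = inv_into UNIV \<psi>"
  have \<theta>: "\<psi> (\<theta> c) = c" if "c \<in> C" for c
    unfolding \<theta>_def using \<psi> that by (metis bij_betw_def f_inv_into_f)
  have \<psi>C: "\<psi> x \<in> C" for x using \<psi> by (auto simp: bij_betw_def)
  have inj: "\<psi> x = \<psi> y \<longleftrightarrow> x = y" for x y using \<psi> by (auto simp: bij_betw_def inj_def)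
  define E where "E = (\<lambda>c. (`) (apfst \<psi> :: _ \<times> bool \<Rightarrow> _) ` Ec (\<theta> c))"
  have lift: "apfst \<psi> ` B \<in> E c" if "B \<in> Ec (\<theta> c)" for B c using that by (auto simp: E_def)
  have mem: "(x, i) \<in> apfst \<psi> ` B" if "(\<theta> x, i) \<in> B" "x \<in> C" for x B and i :: bool
    using that \<theta> by (force simp: image_iff)
  have e1: "E c \<subseteq> quads ((C - {c}) \<times> UNIV)" if c: "c \<in> C" for c
  proof
    fix B assume "B \<in> E c"
    then obtain A where A: "A \<in> Ec (\<theta> c)" "B = apfst \<psi> ` A" by (auto simp: E_def)
    then have Aq: "A \<subseteq> (UNIV - {\<theta> c}) \<times> UNIV" "finite A" "card A \<le> 4"
      using Ec_quads[of "\<theta> c"] by (auto simp: quads_def)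
    have "\<psi> x \<noteq> c" if "x \<noteq> \<theta> c" for x using that \<theta>[OF c] inj by metis
    then have "B \<subseteq> (C - {c}) \<times> UNIV" using Aq(1) \<psi>C by (fastforce simp: A(2))
    moreover have "card B \<le> card A" unfolding A(2) by (rule card_image_le[OF Aq(2)])
    ultimately show "B \<in> quads ((C - {c}) \<times> UNIV)" using Aq by (auto simp: quads_def A(2))
  qed
  have e2: "3 * card (E c) \<le> CARD('k) * (CARD('k) - 1)" for c
  proof -
    have "card (E c) \<le> card (Ec (\<theta> c))" unfolding E_def by (rule card_image_le) simp
    then show ?thesis using card_Ec[of "\<theta> c"] by linarith
  qed
  have e3: "\<exists>B\<in>E c. {(x, i), (y, j)} \<subseteq> B"
    if "x \<in> C - {c}" "y \<in> C - {c}" "c \<in> C" "x \<noteq> y" for x y i j c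
  proof -
    have "\<theta> x \<noteq> \<theta> y" "\<theta> x \<noteq> \<theta> c" "\<theta> y \<noteq> \<theta> c" using \<theta> that by (metis DiffD1 DiffD2 singletonI)+
    then obtain B where B: "B \<in> Ec (\<theta> c)" "{(\<theta> x, i), (\<theta> y, j)} \<subseteq> B" using Ec_pair_cover by blast
    then have "{(x, i), (y, j)} \<subseteq> apfst \<psi> ` B" using mem that by simp
    then show ?thesis using lift[OF B(1)] by blast
  qed
  have e4: "\<exists>c\<in>C. \<exists>B\<in>E c. {(x, i), (y, j), (z, k)} \<subseteq> B"
    if "x \<in> C" "y \<in> C" "z \<in> C" "distinct [x, y, z]" for x y z i j k
  proof -
    have "\<theta> x \<noteq> \<theta> y" "\<theta> x \<noteq> \<theta> z" "\<theta> y \<noteq> \<theta> z"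
      using \<theta>[of x] \<theta>[of y] \<theta>[of z] that by auto
    then have "distinct [\<theta> x, \<theta> y, \<theta> z]" by simp
    then obtain c B where B: "B \<in> Ec c" "{(\<theta> x, i), (\<theta> y, j), (\<theta> z, k)} \<subseteq> B"
      using Ec_triple_cover by blast
    then have "{(x, i), (y, j), (z, k)} \<subseteq> apfst \<psi> ` B" using mem that by simp
    moreover have "\<theta> (\<psi> c) = c" using \<theta>[OF \<psi>C] inj by blast
    then have "apfst \<psi> ` B \<in> E (\<psi> c)" using lift[of B "\<psi> c"] B(1) by simp
    ultimately show ?thesis using \<psi>C by blast
  qed
  show ?thesis by (intro exI[of _ E] conjI ballI allI impI e1 e2 e3 e4)
qed

section \<open>Lines and circles of an extension of finite fields\<close>

locale subfield_pair =
  fixes F K :: "'a::field set" and p q :: nat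
  assumes F: "subfield_set F" and K: "subfield_set K" and KF: "K \<subseteq> F"
    and finF: "finite F" and cardK: "card K = p" and cardF: "card F = q"
begin

lemmas F_closed = subfield_setD[OF F]
lemmas K_closed = subfield_setD[OF K]

lemma finK: "finite K" by (rule finite_subset[OF KF finF])

definition line :: "'a \<Rightarrow> 'a \<Rightarrow> 'a option set" where
  "line a b = insert None (Some ` (\<lambda>t. a + b * t) ` K)"

text \<open>The image of the projective line over \<open>K\<close> under c + 1 / (a + b t), where t
  = infinity gives c. The condition that a / b is not in \<open>K\<close>, imposed in
  \<open>circles\<close>, keeps the denominator nonzero, so the image avoids infinity.\<close>

definition circle :: "'a \<Rightarrow> 'a \<Rightarrow> 'a \<Rightarrow> 'a option set" where
  "circle c a b = Some ` insert c ((\<lambda>t. c + 1 / (a + b * t)) ` K)"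

definition lines :: "'a option set set" where
  "lines = {line a b | a b. a \<in> F \<and> b \<in> F \<and> b \<noteq> 0}"

definition circles :: "'a option set set" where
  "circles = {circle c a b | c a b. c \<in> F \<and> a \<in> F \<and> b \<in> F \<and> b \<noteq> 0 \<and> a / b \<notin> K}"

lemma affine_image_K:
  assumes "t0 \<in> K" "d \<in> K" "d \<noteq> 0"
  shows "(\<lambda>t. t0 + d * t) ` K = K"
proof (rule endo_inj_surj[OF finK])
  show "(\<lambda>t. t0 + d * t) ` K \<subseteq> K" using assms K_closed by auto
  show "inj_on (\<lambda>t. t0 + d * t) K" using assms by (auto intro!: inj_onI)
qed

text \<open>Affine substitutions over \<open>K\<close> place any two chosen parameters at 0 and 1;
  this yields the normal forms behind uniqueness of lines and circles.\<close>

lemma reparam: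
  assumes "t0 \<in> K" "d \<in> K" "d \<noteq> 0"
  shows "(\<lambda>t. f (a + b * t)) ` K = (\<lambda>t. f ((a + b * t0) + (b * d) * t)) ` K"
proof -
  have "(\<lambda>t. f (a + b * t)) ` K = (\<lambda>t. f (a + b * t)) ` (\<lambda>t. t0 + d * t) ` K"
    by (simp only: affine_image_K[OF assms])
  also have "\<dots> = (\<lambda>t. f ((a + b * t0) + (b * d) * t)) ` K"
    by (simp only: image_image distrib_left add.assoc mult.assoc)
  finally show ?thesis .
qed

lemma card_line: "b \<noteq> 0 \<Longrightarrow> card (line a b) = p + 1"
proof -
  assume "b \<noteq> 0"
  then have "card ((\<lambda>t. Some (a + b * t)) ` K) = p"
    using cardK by (subst card_image) (auto intro!: inj_onI)
  then show ?thesis using finK by (simp add: line_def image_image card_insert_if image_iff)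
qed

lemma line_through:
  assumes "C \<in> lines" "Some c \<in> C" "Some x \<in> C" "x \<noteq> c"
  shows "C = line c (x - c)"
proof -
  obtain a b where C: "C = line a b" using assms by (auto simp: lines_def)
  obtain t0 t1 where t: "t0 \<in> K" "t1 \<in> K" "c = a + b * t0" "x = a + b * t1"
    using assms(2,3) by (auto simp: C line_def)
  have d: "t1 - t0 \<in> K" "t1 - t0 \<noteq> 0" using t assms(4) K_closed by auto
  have e: "b * (t1 - t0) = x - c" by (simp add: t right_diff_distrib)
  have "(\<lambda>t. a + b * t) ` K = (\<lambda>t. c + (x - c) * t) ` K"
    using reparam[OF t(1) d, of "\<lambda>x. x" a b] unfolding e t(3)[symmetric] .
  then show ?thesis by (simp add: C line_def)
qed

lemma line_ends: "Some a \<in> line a b" "Some (a + b) \<in> line a b" "None \<in> line a b"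
proof -
  have "a = a + b * 0" "a + b = a + b * 1" by simp_all
  then show "Some a \<in> line a b" "Some (a + b) \<in> line a b" "None \<in> line a b"
    using K_closed(1,2) unfolding line_def by blast+
qed

lemma linesI: "a \<in> F \<Longrightarrow> b \<in> F \<Longrightarrow> b \<noteq> 0 \<Longrightarrow> line a b \<in> lines"
  unfolding lines_def by blast

lemma circlesI:
  "c \<in> F \<Longrightarrow> a \<in> F \<Longrightarrow> b \<in> F \<Longrightarrow> b \<noteq> 0 \<Longrightarrow> a / b \<notin> K \<Longrightarrow> circle c a b \<in> circles"
  unfolding circles_def by blast

lemma line_sub: "C \<in> lines \<Longrightarrow> C \<subseteq> insert None (Some ` F)"
proof -
  assume "C \<in> lines"
  then obtain a b where C: "C = line a b" "a \<in> F" "b \<in> F" by (auto simp: lines_def)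
  have "a + b * t \<in> F" if "t \<in> K" for t using subsetD[OF KF that] C by (simp add: F_closed)
  then show ?thesis by (auto simp: C(1) line_def)
qed

lemma line_props:
  assumes "C \<in> lines" shows "None \<in> C" "card C = p + 1" "finite C"
proof -
  obtain a b where "C = line a b" "b \<noteq> 0" using assms by (auto simp: lines_def)
  then show "None \<in> C" "card C = p + 1" using line_ends(3) card_line by auto
  show "finite C" using line_sub[OF assms] finF finite_subset by blast
qed

lemma denom:
  assumes "a / b \<notin> K" "b \<noteq> 0" "t \<in> K"
  shows "a + b * t \<noteq> 0" "(a + b * t) / b \<notin> K"
proof -
  have e: "(a + b * t) / b = a / b + t" using assms by (simp add: add_divide_distrib)
  show *: "(a + b * t) / b \<notin> K"
  proof
    assume "(a + b * t) / b \<in> K"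
    then have "a / b + t - t \<in> K" unfolding e using assms(3) by (rule K_closed(7))
    then show False using assms(1) by simp
  qed
  then show "a + b * t \<noteq> 0" using K_closed(1) by auto
qed

text \<open>Every point of a circle can play the role of the point with parameter infinity:
  substitute t = t0 + 1 / s.\<close>

lemma circle_rebase:
  assumes C: "C \<in> circles" and c: "Some c \<in> C"
  obtains a b where "C = circle c a b" "c \<in> F" "a \<in> F" "b \<in> F" "b \<noteq> 0" "a / b \<notin> K"
proof -
  obtain c0 a0 b where C: "C = circle c0 a0 b" and F': "c0 \<in> F" "a0 \<in> F" "b \<in> F" "b \<noteq> 0" "a0 / b \<notin> K"
    using C by (auto simp: circles_def)
  show thesis
  proof (cases "c = c0")
    case True
    then show ?thesis using that C F' by blast
  next
    case False
    then obtain t0 where t0: "t0 \<in> K" "c = c0 + 1 / (a0 + b * t0)" using c by (auto simp: C circle_def)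
    define A where "A = a0 + b * t0"
    have A: "A \<noteq> 0" "A / b \<notin> K" "A \<in> F"
      using denom[OF F'(5,4) t0(1)] F' F_closed t0(1) KF by (auto simp: A_def)
    have c: "c = c0 + 1 / A" by (simp add: t0 A_def)
    \<comment> \<open>With c = c0 + 1 / A, solving c0 + 1 / (A + b / s) = c + 1 / (a' + b' s) gives
      a' = -A and this b'. The parameter s = 0 yields the old base point c0.\<close>
    let ?b = "- A\<^sup>2 / b"
    have key: "c + 1 / (- A + ?b * s) = c0 + 1 / (A + b * (1 / s))" if s: "s \<in> K" "s \<noteq> 0" for s
    proof -
      have n1: "A + b * (1 / s) \<noteq> 0" by (rule denom(1)[OF A(2) F'(4) K_closed(8)[OF K_closed(2) s(1)]])
      define E where "E = A * s + b"
      have "E = s * (A + b * (1 / s))" using s by (simp add: E_def distrib_left mult.commute)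
      then have E: "E \<noteq> 0" using n1 s by simp
      have "A * E = A\<^sup>2 * s + A * b" by (simp add: E_def power2_eq_square distrib_left mult.assoc)
      then have "A * E / b = A\<^sup>2 * s / b + A" using F'(4) by (simp add: add_divide_distrib)
      then have "- A + ?b * s = - (A * E) / b" by simp
      moreover have "A + b * (1 / s) = E / s" using s by (simp add: E_def add_divide_distrib)
      moreover have "1 / A + 1 / (- (A * E) / b) = 1 / (E / s)"
      proof -
        have "1 / A + 1 / (- (A * E) / b) = 1 / A - b / (A * E)" by simp
        also have "\<dots> = (E - b) / (A * E)" using A E by (simp add: diff_divide_distrib)
        also have "\<dots> = s / E" using A by (simp add: E_def)
        finally show ?thesis by simp
      qed
      ultimately show ?thesis by (simp add: c add.assoc)
    qed
    have nz: "(\<lambda>s. 1 / s) ` (K - {0}) = K - {0}"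
    proof (intro equalityI subsetI)
      fix x assume "x \<in> K - {0}"
      then have "x = 1 / (1 / x)" "1 / x \<in> K - {0}" using K_closed(8)[OF K_closed(2), of x] by simp_all
      then show "x \<in> (\<lambda>s. 1 / s) ` (K - {0})" by blast
    qed (auto intro: K_closed(8)[OF K_closed(2)])
    have K0: "K = insert 0 (K - {0})" using K_closed(1) by blast
    have "(\<lambda>s. c + 1 / (- A + ?b * s)) ` K = insert c0 ((\<lambda>s. c0 + 1 / (A + b * (1 / s))) ` (K - {0}))"
    proof -
      have "(\<lambda>s. c + 1 / (- A + ?b * s)) ` K
          = insert (c + 1 / (- A + ?b * 0)) ((\<lambda>s. c + 1 / (- A + ?b * s)) ` (K - {0}))"
        by (subst K0) (simp only: image_insert)
      also have "c + 1 / (- A + ?b * 0) = c0" by (simp add: c)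
      also have "(\<lambda>s. c + 1 / (- A + ?b * s)) ` (K - {0}) = (\<lambda>s. c0 + 1 / (A + b * (1 / s))) ` (K - {0})"
        using key by (intro image_cong) auto
      finally show ?thesis .
    qed
    also have "(\<lambda>s. c0 + 1 / (A + b * (1 / s))) ` (K - {0}) = (\<lambda>t. c0 + 1 / (A + b * t)) ` (\<lambda>s. 1 / s) ` (K - {0})"
      by (simp only: image_image)
    also have "\<dots> = (\<lambda>t. c0 + 1 / (A + b * t)) ` (K - {0})" by (simp only: nz)
    finally have "insert c ((\<lambda>s. c + 1 / (- A + ?b * s)) ` K) = insert c0 (insert c ((\<lambda>t. c0 + 1 / (A + b * t)) ` (K - {0})))"
      by (simp add: insert_commute)
    also have "insert c ((\<lambda>t. c0 + 1 / (A + b * t)) ` (K - {0})) = (\<lambda>t. c0 + 1 / (A + b * t)) ` K"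
    proof -
      have "(\<lambda>t. c0 + 1 / (A + b * t)) ` K = insert (c0 + 1 / (A + b * 0)) ((\<lambda>t. c0 + 1 / (A + b * t)) ` (K - {0}))"
        by (subst K0) (simp only: image_insert)
      then show ?thesis by (simp add: c)
    qed
    also have "\<dots> = (\<lambda>t. c0 + 1 / (a0 + b * t)) ` K"
      using reparam[OF t0(1) K_closed(2), of "\<lambda>x. c0 + 1 / x" a0 b] by (simp add: A_def)
    finally have "C = circle c (- A) ?b" by (simp add: C circle_def)
    moreover have "c \<in> F" "- A \<in> F" "?b \<in> F" "?b \<noteq> 0" using A F' by (simp_all add: c F_closed)
    moreover have "- A / ?b \<notin> K"
    proof
      assume "- A / ?b \<in> K"
      moreover have "- A / ?b = b / A" using A by (simp add: power2_eq_square)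
      ultimately have "inverse (b / A) \<in> K" using K_closed(6) by metis
      then show False using A by simp
    qed
    ultimately show ?thesis using that by blast
  qed
qed

text \<open>After rebasing at c and placing x and y at parameters 0 and 1, the coefficients are
  forced. A ratio in \<open>K\<close> would put a / b in \<open>K\<close>, that is, c, x and y on a
  line.\<close>

lemma circle_through:
  assumes C: "C \<in> circles" and c: "Some c \<in> C" "Some x \<in> C" "Some y \<in> C" "x \<noteq> c" "y \<noteq> c" "x \<noteq> y"
  shows "C = circle c (1 / (x - c)) (1 / (y - c) - 1 / (x - c))" "(x - c) / (y - c) \<notin> K"
proof -
  obtain a b where ab: "C = circle c a b" "b \<noteq> 0" "a / b \<notin> K"
    using circle_rebase[OF C c(1)] by metis
  obtain t0 t1 where t: "t0 \<in> K" "t1 \<in> K" "x = c + 1 / (a + b * t0)" "y = c + 1 / (a + b * t1)"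
    using c by (auto simp: ab circle_def)
  have X: "1 / (x - c) = a + b * t0" and Y: "1 / (y - c) = a + b * t1" by (simp_all add: t)
  have d: "t1 - t0 \<in> K" "t1 - t0 \<noteq> 0" using t c(6) K_closed by auto
  have e: "b * (t1 - t0) = 1 / (y - c) - 1 / (x - c)" by (simp only: X Y) (simp add: right_diff_distrib)
  have "(\<lambda>t. c + 1 / (a + b * t)) ` K = (\<lambda>t. c + 1 / (1 / (x - c) + (1 / (y - c) - 1 / (x - c)) * t)) ` K"
    using reparam[OF t(1) d, of "\<lambda>x. c + 1 / x" a b] unfolding e X[symmetric] .
  then show "C = circle c (1 / (x - c)) (1 / (y - c) - 1 / (x - c))" by (simp add: ab circle_def)
  show "(x - c) / (y - c) \<notin> K"
  proof
    define A where "A = a + b * t0"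
    have A: "A \<noteq> 0" "A / b \<notin> K" using denom[OF ab(3,2) t(1)] by (simp_all add: A_def)
    assume "(x - c) / (y - c) \<in> K"
    moreover have "(x - c) / (y - c) = (a + b * t1) / A"
      by (simp add: t A_def)
    moreover have "a + b * t1 = A + b * (t1 - t0)" by (simp add: A_def right_diff_distrib)
    ultimately have "(A + b * (t1 - t0)) / A \<in> K" by simp
    moreover have "(A + b * (t1 - t0)) / A = 1 + (t1 - t0) / (A / b)"
      using A ab(2) by (simp add: add_divide_distrib)
    ultimately have "1 + (t1 - t0) / (A / b) - 1 \<in> K" using K_closed(2,7) by metis
    then have k: "(t1 - t0) / (A / b) \<in> K" by simp
    then have "(t1 - t0) / ((t1 - t0) / (A / b)) \<in> K" using d(1) K_closed(8) by blast
    moreover have "(t1 - t0) / ((t1 - t0) / (A / b)) = A / b" using d A by simp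
    ultimately show False using A by simp
  qed
qed

lemma circle_exists:
  assumes F': "c \<in> F" "x \<in> F" "y \<in> F" and ne: "x \<noteq> c" "y \<noteq> c" and K': "(x - c) / (y - c) \<notin> K"
  shows "\<exists>C\<in>circles. {Some c, Some x, Some y} \<subseteq> C"
proof -
  let ?a = "1 / (x - c)" let ?b = "1 / (y - c) - 1 / (x - c)"
  have "x \<noteq> y" using K' ne K_closed(2) by auto
  then have b: "?b \<noteq> 0" by (auto simp flip: inverse_eq_divide)
  have "?a / ?b \<notin> K"
  proof
    assume k: "?a / ?b \<in> K"
    have "1 / (?a / ?b) = (x - c) * ?b" using ne by simp
    also have "\<dots> = (x - c) / (y - c) - 1" using ne by (simp add: right_diff_distrib)
    finally have "(x - c) / (y - c) = 1 / (?a / ?b) + 1" by simp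
    also have "\<dots> \<in> K" by (rule K_closed(3)[OF K_closed(8)[OF K_closed(2) k] K_closed(2)])
    finally show False using K' by simp
  qed
  moreover have "?a \<in> F" "?b \<in> F" using F' by (simp_all add: F_closed)
  ultimately have "circle c ?a ?b \<in> circles" using F'(1) b by (intro circlesI)
  moreover have "Some c \<in> circle c ?a ?b" by (simp add: circle_def)
  moreover have "x = c + 1 / (?a + ?b * 0)" "y = c + 1 / (?a + ?b * 1)" using ne by simp_all
  then have "Some x \<in> circle c ?a ?b" "Some y \<in> circle c ?a ?b"
    using K_closed(1,2) unfolding circle_def by blast+
  ultimately show ?thesis by blast
qed

lemma circle_sub: "C \<in> circles \<Longrightarrow> C \<subseteq> Some ` F"
proof -
  assume "C \<in> circles"
  then obtain c a b where C: "C = circle c a b" "c \<in> F" "a \<in> F" "b \<in> F" by (auto simp: circles_def)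
  have "c + 1 / (a + b * t) \<in> F" if "t \<in> K" for t using subsetD[OF KF that] C by (simp add: F_closed)
  then show ?thesis using C(2) by (auto simp: C(1) circle_def)
qed

lemma circle_props:
  assumes "C \<in> circles" shows "card C = p + 1" "finite C"
proof -
  obtain c a b where C: "C = circle c a b" "b \<noteq> 0" "a / b \<notin> K" using assms by (auto simp: circles_def)
  have inj: "inj_on (\<lambda>t. c + 1 / (a + b * t)) K"
  proof (rule inj_onI)
    fix s t assume "c + 1 / (a + b * s) = c + 1 / (a + b * t)"
    then have "inverse (a + b * s) = inverse (a + b * t)" by (simp add: inverse_eq_divide)
    then show "s = t" using C by simp
  qed
  have "c \<notin> (\<lambda>t. c + 1 / (a + b * t)) ` K" using denom(1)[OF C(3,2)] by auto
  then have "card (insert c ((\<lambda>t. c + 1 / (a + b * t)) ` K)) = p + 1"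
    using card_image[OF inj] cardK finK by simp
  then show "card C = p + 1" unfolding C circle_def by (subst card_image) auto
  show "finite C" using circle_sub[OF assms] finF finite_subset by blast
qed

section \<open>Numbers of lines and circles through a point\<close>

lemma card_lines_through:
  assumes "c \<in> F"
  shows "card {C \<in> lines. Some c \<in> C} * (p - 1) \<le> q - 1"
proof -
  let ?L = "{C \<in> lines. Some c \<in> C}"
  \<comment> \<open>Away from infinity and c the lines through c are disjoint, by the normal form of
    \<open>line_through\<close>.\<close>
  let ?f = "\<lambda>C. C - {None, Some c}"
  have "?L \<subseteq> Pow (insert None (Some ` F))" using line_sub by blast
  then have finL: "finite ?L" by (rule finite_subset) (simp add: finF)
  have card: "card (?f C) = p - 1" if "C \<in> ?L" for C
    using line_props[of C] that by (simp add: card_Diff_subset)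
  have "card ?L * (p - 1) = (\<Sum>C\<in>?L. card (?f C))" using card by simp
  also have "\<dots> = card (\<Union>C\<in>?L. ?f C)"
  proof (rule card_UN_disjoint[symmetric, OF finL])
    show "\<forall>C\<in>?L. finite (?f C)" using line_props by auto
    show "\<forall>C\<in>?L. \<forall>C'\<in>?L. C \<noteq> C' \<longrightarrow> ?f C \<inter> ?f C' = {}"
    proof (intro ballI impI, rule ccontr)
      fix C C' assume CC: "C \<in> ?L" "C' \<in> ?L" "C \<noteq> C'" "?f C \<inter> ?f C' \<noteq> {}"
      then obtain P where "P \<in> C" "P \<in> C'" "P \<noteq> None" "P \<noteq> Some c" by blast
      then obtain x where x: "Some x \<in> C" "Some x \<in> C'" "x \<noteq> c" by auto
      have L: "C \<in> lines" "Some c \<in> C" "C' \<in> lines" "Some c \<in> C'" using CC(1,2) by simp_all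
      have "C = line c (x - c)" "C' = line c (x - c)"
        by (rule line_through[OF L(1,2) x(1,3)], rule line_through[OF L(3,4) x(2,3)])
      then show False using CC(3) by simp
    qed
  qed
  also have "\<dots> \<le> card (Some ` (F - {c}))"
  proof (rule card_mono)
    show "(\<Union>C\<in>?L. ?f C) \<subseteq> Some ` (F - {c})"
    proof
      fix P assume "P \<in> (\<Union>C\<in>?L. ?f C)"
      then obtain C where "C \<in> lines" "P \<in> C" "P \<noteq> None" "P \<noteq> Some c" by blast
      then show "P \<in> Some ` (F - {c})" using line_sub[of C] by blast
    qed
  qed (use finF in auto)
  also have "\<dots> = q - 1" using assms cardF finF by (simp add: card_image)
  finally show ?thesis .
qed

text \<open>With c removed, the circles through c become blocks of p points, no two of which share a
  pair. They cover only pairs whose ratio relative to c is outside \<open>K\<close>, at most (q - 1)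
  (q - p) ordered ones.\<close>

lemma card_circles_through:
  assumes c: "c \<in> F"
  shows "card {C \<in> circles. Some c \<in> C} * (p * (p - 1)) \<le> (q - 1) * (q - p)"
proof -
  let ?L = "{C \<in> circles. Some c \<in> C}"
  let ?f = "\<lambda>C. C - {Some c}"
  let ?V = "Some ` (F - {c})"
  have inj: "inj_on ?f ?L"
  proof (rule inj_onI)
    fix C C' assume C: "C \<in> ?L" "C' \<in> ?L" and e: "?f C = ?f C'"
    have "C = insert (Some c) (?f C)" using C(1) by (simp add: insert_absorb)
    also have "\<dots> = C'" unfolding e using C(2) by (simp add: insert_absorb)
    finally show "C = C'" .
  qed
  have B: "B \<subseteq> ?V \<and> card B = p" if hB: "B \<in> ?f ` ?L" for B
  proof -
    obtain C where C: "B = ?f C" "C \<in> ?L" using hB by (rule imageE)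
    then have "C \<subseteq> Some ` F" using circle_sub by simp
    then have "B \<subseteq> ?V" by (auto simp: C(1))
    moreover have "card B = p" using C circle_props[of C] by simp
    ultimately show ?thesis ..
  qed
  have "card (?f ` ?L) * (p * (p - 1)) \<le>
    card {(x, y). x \<in> ?V \<and> y \<in> ?V \<and> x \<noteq> y \<and> (\<exists>B\<in>?f ` ?L. {x, y} \<subseteq> B)}"
  proof (rule packing_bound[OF _ B])
    fix B B' x y assume BB: "B \<in> ?f ` ?L" "B' \<in> ?f ` ?L" "x \<noteq> y" "{x, y} \<subseteq> B" "{x, y} \<subseteq> B'"
    obtain C where C: "B = ?f C" "C \<in> ?L" using BB(1) by (rule imageE)
    obtain C' where C': "B' = ?f C'" "C' \<in> ?L" using BB(2) by (rule imageE)
    have "x \<in> ?V" "y \<in> ?V" using B[OF BB(1)] BB(4) by auto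
    then obtain a b where ab: "x = Some a" "y = Some b" "a \<noteq> c" "b \<noteq> c" by auto
    have m: "Some a \<in> C" "Some b \<in> C" "Some a \<in> C'" "Some b \<in> C'" "a \<noteq> b"
      using BB(3-5) unfolding ab C(1) C'(1) by auto
    have L: "C \<in> circles" "Some c \<in> C" "C' \<in> circles" "Some c \<in> C'" using C(2) C'(2) by simp_all
    have "C = circle c (1 / (a - c)) (1 / (b - c) - 1 / (a - c))"
      by (rule circle_through(1)[OF L(1,2) m(1,2) ab(3,4) m(5)])
    moreover have "C' = circle c (1 / (a - c)) (1 / (b - c) - 1 / (a - c))"
      by (rule circle_through(1)[OF L(3,4) m(3,4) ab(3,4) m(5)])
    ultimately show "B = B'" unfolding C(1) C'(1) by simp
  qed (use finF in auto)
  also have "\<dots> \<le> card (SIGMA y:F - {c}. {x \<in> F - {c}. (x - c) / (y - c) \<notin> K})"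
  proof -
    have "{(x, y). x \<in> ?V \<and> y \<in> ?V \<and> x \<noteq> y \<and> (\<exists>B\<in>?f ` ?L. {x, y} \<subseteq> B)} \<subseteq>
      (\<lambda>(y, x). (Some x, Some y)) ` (SIGMA y:F - {c}. {x \<in> F - {c}. (x - c) / (y - c) \<notin> K})"
    proof (rule subsetI)
      fix t assume "t \<in> {(x, y). x \<in> ?V \<and> y \<in> ?V \<and> x \<noteq> y \<and> (\<exists>B\<in>?f ` ?L. {x, y} \<subseteq> B)}"
      then obtain x y B where t: "t = (x, y)" "x \<in> ?V" "y \<in> ?V" "x \<noteq> y" and hB: "B \<in> ?f ` ?L" "{x, y} \<subseteq> B"
        by auto
      obtain C where C: "B = ?f C" "C \<in> ?L" using hB(1) by (rule imageE)
      obtain a where a: "x = Some a" "a \<in> F" "a \<noteq> c" using t(2) by auto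
      obtain b where b: "y = Some b" "b \<in> F" "b \<noteq> c" using t(3) by auto
      have L: "C \<in> circles" "Some c \<in> C" "Some a \<in> C" "Some b \<in> C" "a \<noteq> b"
        using C hB(2) t(4) unfolding a b by auto
      have "(a - c) / (b - c) \<notin> K" by (rule circle_through(2)[OF L(1-4) a(3) b(3) L(5)])
      then have "(b, a) \<in> (SIGMA y:F - {c}. {x \<in> F - {c}. (x - c) / (y - c) \<notin> K})" using a b by simp
      then show "t \<in> (\<lambda>(y, x). (Some x, Some y)) ` (SIGMA y:F - {c}. {x \<in> F - {c}. (x - c) / (y - c) \<notin> K})"
        by (rule image_eqI[rotated]) (simp add: t a b)
    qed
    then have "card {(x, y). x \<in> ?V \<and> y \<in> ?V \<and> x \<noteq> y \<and> (\<exists>B\<in>?f ` ?L. {x, y} \<subseteq> B)} \<le>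
      card ((\<lambda>(y, x). (Some x, Some y)) ` (SIGMA y:F - {c}. {x \<in> F - {c}. (x - c) / (y - c) \<notin> K}))"
      by (rule card_mono[rotated]) (use finF in auto)
    also have "\<dots> \<le> card (SIGMA y:F - {c}. {x \<in> F - {c}. (x - c) / (y - c) \<notin> K})"
      by (rule card_image_le) (use finF in auto)
    finally show ?thesis .
  qed
  also have "\<dots> = (\<Sum>y\<in>F - {c}. card {x \<in> F - {c}. (x - c) / (y - c) \<notin> K})"
    using finF by (simp add: card_SigmaI)
  also have "\<dots> \<le> (\<Sum>y\<in>F - {c}. q - p)"
  proof (rule sum_mono)
    fix y assume y: "y \<in> F - {c}"
    let ?g = "\<lambda>t. c + (y - c) * t"
    \<comment> \<open>The excluded points are those of the affine line through c and y, p of them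
      including c.\<close>
    have "{x \<in> F - {c}. (x - c) / (y - c) \<notin> K} \<subseteq> F - ?g ` K" using y by auto
    then have "card {x \<in> F - {c}. (x - c) / (y - c) \<notin> K} \<le> card (F - ?g ` K)"
      using finF by (intro card_mono) auto
    also have "\<dots> = card F - card (?g ` K)"
    proof (rule card_Diff_subset)
      show "?g ` K \<subseteq> F"
      proof
        fix x assume "x \<in> ?g ` K"
        then obtain t where "t \<in> F" "x = c + (y - c) * t" using KF by auto
        then show "x \<in> F" using y c by (simp add: F_closed)
      qed
    qed (simp add: finK)
    also have "card (?g ` K) = p" using y cardK by (subst card_image) (auto intro!: inj_onI)
    finally show "card {x \<in> F - {c}. (x - c) / (y - c) \<notin> K} \<le> q - p" by (simp add: cardF)
  qed
  also have "\<dots> = (q - 1) * (q - p)" using c cardF finF by simp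
  finally show ?thesis by (simp add: card_image[OF inj])
qed

end

section \<open>Gluing\<close>

lemma card_insert_le_Suc: "card (insert a A) \<le> Suc (card A)"
  by (cases "finite A") (simp_all add: card_insert_if)

lemma quads_mono: "A \<subseteq> B \<Longrightarrow> quads A \<subseteq> quads B"
  by (auto simp: quads_def)

context subfield_pair
begin

lemma line_exists:
  assumes "c \<in> F" "a \<in> F" "b \<in> F" "a \<noteq> c \<Longrightarrow> (b - c) / (a - c) \<in> K" "a = c \<Longrightarrow> b = c"
  shows "\<exists>C\<in>lines. {None, Some c, Some a, Some b} \<subseteq> C"
proof (cases "a = c")
  case True
  have "line c 1 \<in> lines" using assms(1) by (intro linesI) (simp_all add: F_closed)
  then show ?thesis using line_ends[of c 1] True assms(5) by auto
next
  case False
  have "line c (a - c) \<in> lines" using assms False by (intro linesI) (simp_all add: F_closed)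
  moreover have "b = c + (a - c) * ((b - c) / (a - c))" using False by simp
  then have "Some b \<in> line c (a - c)" using assms(4)[OF False] unfolding line_def by blast
  ultimately show ?thesis using line_ends[of c "a - c"] by auto
qed

lemma two_on_line:
  assumes "x \<in> insert None (Some ` F)" "y \<in> insert None (Some ` F)"
  shows "\<exists>C\<in>lines. {None, x, y} \<subseteq> C"
proof -
  \<comment> \<open>Every line contains infinity, so \<open>None\<close> imposes no condition and is
    replaced by an arbitrary affine point.\<close>
  have *: "\<exists>a\<in>F. z = None \<or> z = Some a" if "z \<in> insert None (Some ` F)" for z
    using that F_closed(1) by (cases z) auto
  obtain a where a: "a \<in> F" "x = None \<or> x = Some a" using *[OF assms(1)] by (rule bexE)
  obtain b where b: "b \<in> F" "y = None \<or> y = Some b" using *[OF assms(2)] by (rule bexE)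
  have "\<exists>C\<in>lines. {None, Some a, Some b, Some b} \<subseteq> C"
    by (rule line_exists[OF a(1) b(1) b(1)]) (simp_all add: K_closed(2))
  then show ?thesis using a(2) b(2) by auto
qed

text \<open>Decides where colour c covers a pair above x and y. All coincidences go to lines,
  including x = y and the case that one of them is c: the circle systems cover only pairs above two
  distinct points other than the colour.\<close>

lemma line_or_circle_base:
  assumes c: "c \<in> F" and "x \<in> insert None (Some ` F)" "y \<in> insert None (Some ` F)"
  shows "(\<exists>C\<in>lines. {Some c, x, y} \<subseteq> C) \<or> (\<exists>C\<in>circles. {Some c, x, y} \<subseteq> C \<and> distinct [Some c, x, y])"
proof (cases "x = None \<or> y = None \<or> x = Some c \<or> y = Some c \<or> x = y")
  case True
  have "\<exists>z\<in>insert None (Some ` F). {Some c, x, y} \<subseteq> {None, Some c, z}"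
    using True
  proof (elim disjE)
    assume "x = None" then show ?thesis by (intro bexI[of _ y] assms(3)) simp
  next
    assume "y = None" then show ?thesis by (intro bexI[of _ x] assms(2)) simp
  next
    assume "x = Some c" then show ?thesis by (intro bexI[of _ y] assms(3)) simp
  next
    assume "y = Some c" then show ?thesis by (intro bexI[of _ x] assms(2)) simp
  next
    assume "x = y" then show ?thesis by (intro bexI[of _ y] assms(3)) simp
  qed
  then obtain z where z: "z \<in> insert None (Some ` F)" "{Some c, x, y} \<subseteq> {None, Some c, z}" by blast
  have "\<exists>C\<in>lines. {None, Some c, z} \<subseteq> C" by (rule two_on_line[OF _ z(1)]) (simp add: c)
  then obtain C where C: "C \<in> lines" "{None, Some c, z} \<subseteq> C" by (rule bexE)
  have "{Some c, x, y} \<subseteq> C" using z(2) C(2) by (rule order_trans)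
  then show ?thesis using C(1) by blast
next
  case False
  then obtain a where a: "x = Some a" "a \<in> F" "a \<noteq> c" using assms(2) by (cases x) auto
  obtain b where b: "y = Some b" "b \<in> F" "b \<noteq> c" using False assms(3) by (cases y) auto
  have "a \<noteq> b" using False a b by simp
  note ab = a(1) b(1) a(2) b(2) a(3) b(3) \<open>a \<noteq> b\<close>
  show ?thesis
  proof (cases "(a - c) / (b - c) \<in> K")
    case True
    then obtain C where "C \<in> lines" "{None, Some c, Some b, Some a} \<subseteq> C"
      using line_exists[OF c ab(4,3)] ab(6) by blast
    then show ?thesis unfolding ab(1,2) by blast
  next
    case False
    then obtain C where "C \<in> circles" "{Some c, Some a, Some b} \<subseteq> C"
      using circle_exists[OF c ab(3,4,5,6)] by blast
    moreover have "distinct [Some c, Some a, Some b]" using ab(5-7) by auto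
    ultimately show ?thesis unfolding ab(1,2) by blast
  qed
qed

lemma line_or_circle:
  assumes "x \<in> insert None (Some ` F)" "y \<in> insert None (Some ` F)" "z \<in> insert None (Some ` F)"
  shows "(\<exists>C\<in>lines. {x, y, z} \<subseteq> C) \<or> (\<exists>C\<in>circles. {x, y, z} \<subseteq> C \<and> distinct [x, y, z])"
proof (cases x)
  case None
  then show ?thesis using two_on_line[of y z] assms by simp
next
  case (Some c)
  then show ?thesis using line_or_circle_base[of c y z] assms by auto
qed

lemma ex_resolved:
  assumes pk: "p + 1 = 2 ^ k" "odd k" and kk: "CARD('k::finite_field) = p" "p mod 12 = 7"
  shows "\<exists>D. resolved (insert None (Some ` F) \<times> (UNIV :: bool set)) F D \<and>
    (\<forall>c\<in>F. 12 * card (D c) \<le> (2 * q + 2) * (2 * q + 1))"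
proof -
  let ?P = "insert None (Some ` F)"
  have "\<exists>D. resolved (C \<times> (UNIV :: bool set)) (C - {None}) D \<and>
    (\<forall>c\<in>C - {None}. 12 * card (D c) \<le> (2 * card C) * (2 * card C - 1) \<and> {None, c} \<times> UNIV \<in> D c)"
    if "C \<in> lines" for C
    \<comment> \<open>A line has p + 1 = 2^k points; infinity is the distinguished one.\<close>
    using line_props[OF that] pk by (intro vertical_design[of k]) simp_all
  then obtain BD where BD: "\<And>C. C \<in> lines \<Longrightarrow> resolved (C \<times> (UNIV :: bool set)) (C - {None}) (BD C)"
    "\<And>C c. C \<in> lines \<Longrightarrow> c \<in> C - {None} \<Longrightarrow> 12 * card (BD C c) \<le> (2 * card C) * (2 * card C - 1)"
    "\<And>C c. C \<in> lines \<Longrightarrow> c \<in> C - {None} \<Longrightarrow> {None, c} \<times> UNIV \<in> BD C c"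
    by metis
  have "\<exists>E. (\<forall>c\<in>C. E c \<subseteq> quads ((C - {c}) \<times> (UNIV :: bool set)) \<and>
        3 * card (E c) \<le> p * (p - 1) \<and>
        (\<forall>x\<in>C - {c}. \<forall>y\<in>C - {c}. \<forall>i j. x \<noteq> y \<longrightarrow> (\<exists>B\<in>E c. {(x, i), (y, j)} \<subseteq> B))) \<and>
      (\<forall>x\<in>C. \<forall>y\<in>C. \<forall>z\<in>C. \<forall>i j k. distinct [x, y, z] \<longrightarrow>
        (\<exists>c\<in>C. \<exists>B\<in>E c. {(x, i), (y, j), (z, k)} \<subseteq> B))"
    if "C \<in> circles" for C
    using circle_design[where 'k='k, of C] circle_props[OF that] kk by simp
  then obtain ED where ED: "\<And>C. C \<in> circles \<Longrightarrow> (\<forall>c\<in>C. ED C c \<subseteq> quads ((C - {c}) \<times> (UNIV :: bool set)) \<and>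
        3 * card (ED C c) \<le> p * (p - 1) \<and>
        (\<forall>x\<in>C - {c}. \<forall>y\<in>C - {c}. \<forall>i j. x \<noteq> y \<longrightarrow> (\<exists>B\<in>ED C c. {(x, i), (y, j)} \<subseteq> B))) \<and>
      (\<forall>x\<in>C. \<forall>y\<in>C. \<forall>z\<in>C. \<forall>i j k. distinct [x, y, z] \<longrightarrow>
        (\<exists>c\<in>C. \<exists>B\<in>ED C c. {(x, i), (y, j), (z, k)} \<subseteq> B))"
    by metis
  have E12: "ED C c \<subseteq> quads ((C - {c}) \<times> (UNIV :: bool set))" "3 * card (ED C c) \<le> p * (p - 1)"
    if "C \<in> circles" "c \<in> C" for C c
    using conjunct1[OF ED[OF that(1)], THEN bspec, OF that(2)] by blast+
  have E3: "\<exists>B\<in>ED C c. {(x, i), (y, j)} \<subseteq> B"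
    if "C \<in> circles" "c \<in> C" "x \<in> C - {c}" "y \<in> C - {c}" "x \<noteq> y" for C c x y i j
    by (rule conjunct2[OF conjunct2[OF conjunct1[OF ED[OF that(1)], THEN bspec, OF that(2)]], rule_format, OF that(3-5)])
  have E4: "\<exists>c\<in>C. \<exists>B\<in>ED C c. {(x, i), (y, j), (z, l)} \<subseteq> B"
    if "C \<in> circles" "x \<in> C" "y \<in> C" "z \<in> C" "distinct [x, y, z]" for C x y z i j l
    by (rule conjunct2[OF ED[OF that(1)], rule_format, OF that(2-5)])
  define L where "L = (\<lambda>c. {C \<in> lines. Some c \<in> C})"
  define R where "R = (\<lambda>c. {C \<in> circles. Some c \<in> C})"
  define D1 where "D1 = (\<lambda>c. \<Union>C\<in>L c. BD C (Some c))"
  define D2 where "D2 = (\<lambda>c. \<Union>C\<in>R c. ED C (Some c))"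
  have BDq: "BD C (Some c) \<subseteq> quads (?P \<times> UNIV)" if "C \<in> L c" for C c
  proof -
    have C: "C \<in> lines" "Some c \<in> C - {None}" using that by (auto simp: L_def)
    then have "BD C (Some c) \<subseteq> quads (C \<times> UNIV)" using BD(1)[OF C(1)] by (simp add: resolved_def)
    moreover have "C \<times> UNIV \<subseteq> ?P \<times> UNIV" using line_sub[OF C(1)] by blast
    ultimately show ?thesis using quads_mono by blast
  qed
  have EDq: "ED C (Some c) \<subseteq> quads (?P \<times> UNIV)" if "C \<in> R c" for C c
  proof -
    have C: "C \<in> circles" "Some c \<in> C" using that by (auto simp: R_def)
    then have "ED C (Some c) \<subseteq> quads ((C - {Some c}) \<times> UNIV)" using E12(1) by simp
    moreover have "(C - {Some c}) \<times> UNIV \<subseteq> ?P \<times> UNIV" using circle_sub[OF C(1)] by blast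
    ultimately show ?thesis using quads_mono by blast
  qed
  have finq: "finite (quads (?P \<times> (UNIV :: bool set)))" by (rule finite_quads) (simp add: finF)
  have "resolved (?P \<times> (UNIV :: bool set)) F (\<lambda>c. D1 c \<union> D2 c)"
    unfolding resolved_def
  proof (intro conjI ballI impI)
    fix c assume c: "c \<in> F"
    show "D1 c \<union> D2 c \<subseteq> quads (?P \<times> UNIV)" using BDq EDq unfolding D1_def D2_def by blast
    fix s t assume st: "s \<in> ?P \<times> (UNIV :: bool set)" "t \<in> ?P \<times> (UNIV :: bool set)" "s \<noteq> t"
    obtain x i where s: "s = (x, i)" "x \<in> ?P" using st(1) by blast
    obtain y j where t: "t = (y, j)" "y \<in> ?P" using st(2) by blast
    from line_or_circle_base[OF c s(2) t(2)] show "\<exists>B\<in>D1 c \<union> D2 c. {s, t} \<subseteq> B"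
    proof
      assume "\<exists>C\<in>lines. {Some c, x, y} \<subseteq> C"
      then obtain C where C: "C \<in> lines" "Some c \<in> C" "x \<in> C" "y \<in> C" by auto
      then have "\<exists>B\<in>BD C (Some c). {s, t} \<subseteq> B"
        using BD(1)[OF C(1)] st(3) unfolding resolved_def s t by simp
      moreover have "C \<in> L c" using C by (simp add: L_def)
      ultimately show ?thesis unfolding D1_def by blast
    next
      assume "\<exists>C\<in>circles. {Some c, x, y} \<subseteq> C \<and> distinct [Some c, x, y]"
      then obtain C where C: "C \<in> circles" "Some c \<in> C" "x \<in> C - {Some c}" "y \<in> C - {Some c}" "x \<noteq> y" by auto
      then have "\<exists>B\<in>ED C (Some c). {s, t} \<subseteq> B"
        unfolding s t by (intro E3)
      moreover have "C \<in> R c" using C by (simp add: R_def)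
      ultimately show ?thesis unfolding D2_def by blast
    qed
  next
    fix s t u assume st: "s \<in> ?P \<times> (UNIV :: bool set)" "t \<in> ?P \<times> (UNIV :: bool set)" "u \<in> ?P \<times> (UNIV :: bool set)"
      "s \<noteq> t \<and> s \<noteq> u \<and> t \<noteq> u"
    obtain x i where s: "s = (x, i)" "x \<in> ?P" using st(1) by blast
    obtain y j where t: "t = (y, j)" "y \<in> ?P" using st(2) by blast
    obtain z l where u: "u = (z, l)" "z \<in> ?P" using st(3) by blast
    from line_or_circle[OF s(2) t(2) u(2)] show "\<exists>c\<in>F. \<exists>B\<in>D1 c \<union> D2 c. {s, t, u} \<subseteq> B"
    proof
      assume "\<exists>C\<in>lines. {x, y, z} \<subseteq> C"
      then obtain C where C: "C \<in> lines" "x \<in> C" "y \<in> C" "z \<in> C" by auto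
      then have "\<exists>c\<in>C - {None}. \<exists>B\<in>BD C c. {s, t, u} \<subseteq> B"
        using BD(1)[OF C(1)] st(4) unfolding resolved_def s t u by simp
      then obtain d B where d: "d \<in> C - {None}" "B \<in> BD C d" "{s, t, u} \<subseteq> B" by blast
      then obtain c where c: "d = Some c" "c \<in> F" using line_sub[OF C(1)] by auto
      then have "C \<in> L c" using C(1) d(1) by (simp add: L_def)
      then have "B \<in> D1 c" using d(2) c(1) unfolding D1_def by blast
      then show ?thesis using c(2) d(3) by blast
    next
      assume "\<exists>C\<in>circles. {x, y, z} \<subseteq> C \<and> distinct [x, y, z]"
      then obtain C where C: "C \<in> circles" "x \<in> C" "y \<in> C" "z \<in> C" "distinct [x, y, z]" by auto
      then have "\<exists>d\<in>C. \<exists>B\<in>ED C d. {s, t, u} \<subseteq> B" unfolding s t u by (intro E4)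
      then obtain d B where d: "d \<in> C" "B \<in> ED C d" "{s, t, u} \<subseteq> B" by blast
      then obtain c where c: "d = Some c" "c \<in> F" using circle_sub[OF C(1)] by auto
      then have "C \<in> R c" using C(1) d(1) by (simp add: R_def)
      then have "B \<in> D2 c" using d(2) c(1) unfolding D2_def by blast
      then show ?thesis using c(2) d(3) by blast
    qed
  qed
  moreover have "12 * card (D1 c \<union> D2 c) \<le> (2 * q + 2) * (2 * q + 1)" if c: "c \<in> F" for c
  proof -
    \<comment> \<open>The block shared by all lines through c. It is removed from each line and
      counted once; without this the total would exceed the budget as soon as there are two
      lines.\<close>
    let ?B0 = "{None, Some c} \<times> (UNIV :: bool set)"
    have pq: "p \<le> q" using card_mono[OF finF KF] cardK cardF by simp
    have p7: "p \<ge> 7" using kk(2) by (metis mod_less_eq_dividend)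
    have finL: "finite (L c)" "finite (R c)"
    proof -
      have "L c \<subseteq> Pow ?P" using line_sub unfolding L_def by blast
      then show "finite (L c)" by (rule finite_subset) (simp add: finF)
      have "R c \<subseteq> Pow ?P" using circle_sub unfolding R_def by blast
      then show "finite (R c)" by (rule finite_subset) (simp add: finF)
    qed
    have finBD: "finite (BD C (Some c))" if "C \<in> L c" for C using BDq[OF that] finq finite_subset by blast
    \<comment> \<open>One line has (2 p + 2) (2 p + 1) / 12 blocks; without the shared one, twelve
      times the rest is 4 p^2 + 6 p - 10. Its factor p - 1 matches the bound on the number of
      lines.\<close>
    have bd1: "12 * card (BD C (Some c) - {?B0}) \<le> (p - 1) * (4 * p + 10)" if C: "C \<in> L c" for C
    proof -
      have C': "C \<in> lines" "Some c \<in> C - {None}" "card C = p + 1"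
        using C line_props(2) by (simp_all add: L_def)
      have "?B0 \<in> BD C (Some c)" by (rule BD(3)[OF C'(1,2)])
      then have "12 * card (BD C (Some c) - {?B0}) = 12 * card (BD C (Some c)) - 12"
        using finBD[OF C] by (simp add: card_Diff_singleton)
      also have "\<dots> \<le> (2 * (p + 1)) * (2 * (p + 1) - 1) - 12"
        using BD(2)[OF C'(1,2)] unfolding C'(3) by (rule diff_le_mono)
      also have "\<dots> = (p - 1) * (4 * p + 10)"
      proof -
        obtain r where "p = r + 1" using p7 by (intro that[of "p - 1"]) simp
        then show ?thesis by (simp add: algebra_simps)
      qed
      finally show ?thesis .
    qed
    have "D1 c \<subseteq> insert ?B0 (\<Union>C\<in>L c. BD C (Some c) - {?B0})" unfolding D1_def by blast
    then have "card (D1 c) \<le> card (insert ?B0 (\<Union>C\<in>L c. BD C (Some c) - {?B0}))"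
      using finL finBD by (intro card_mono) auto
    also have "\<dots> \<le> Suc (card (\<Union>C\<in>L c. BD C (Some c) - {?B0}))" 
      by (rule card_insert_le_Suc)
    also have "\<dots> \<le> Suc (\<Sum>C\<in>L c. card (BD C (Some c) - {?B0}))"
      by (rule Suc_leI, rule le_imp_less_Suc, rule card_UN_le[OF finL(1)])
    finally have "12 * card (D1 c) \<le> 12 + (\<Sum>C\<in>L c. 12 * card (BD C (Some c) - {?B0}))"
      by (simp add: sum_distrib_left[symmetric])
    also have "\<dots> \<le> 12 + (\<Sum>C\<in>L c. (p - 1) * (4 * p + 10))" using bd1 by (intro add_left_mono sum_mono)
    also have "\<dots> = 12 + (card (L c) * (p - 1)) * (4 * p + 10)" by simp
    also have "\<dots> \<le> 12 + (q - 1) * (4 * p + 10)"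
      using card_lines_through[OF c] unfolding L_def by (intro add_left_mono mult_right_mono) simp_all
    finally have D1: "12 * card (D1 c) \<le> 12 + (q - 1) * (4 * p + 10)" .
    have "card (D2 c) \<le> (\<Sum>C\<in>R c. card (ED C (Some c)))"
      unfolding D2_def by (rule card_UN_le[OF finL(2)])
    then have "12 * card (D2 c) \<le> 4 * (\<Sum>C\<in>R c. 3 * card (ED C (Some c)))"
      by (simp add: sum_distrib_left[symmetric])
    also have "\<dots> \<le> 4 * (\<Sum>C\<in>R c. p * (p - 1))"
      using E12(2) by (intro mult_left_mono sum_mono) (simp_all add: R_def)
    also have "\<dots> = 4 * (card (R c) * (p * (p - 1)))" by simp
    also have "\<dots> \<le> 4 * ((q - 1) * (q - p))"
      using card_circles_through[OF c] unfolding R_def by (intro mult_left_mono) simp_all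
    finally have D2: "12 * card (D2 c) \<le> 4 * ((q - 1) * (q - p))" .
    have "12 * card (D1 c \<union> D2 c) \<le> 12 * card (D1 c) + 12 * card (D2 c)"
      using card_Un_le[of "D1 c" "D2 c"] by linarith
    also have "\<dots> \<le> 12 + (q - 1) * (4 * p + 10) + 4 * ((q - 1) * (q - p))" using D1 D2 by linarith
    \<comment> \<open>In the sum p cancels: 12 + (q - 1) (4 q + 10) is exactly v (v - 1) for v = 2 q
      + 2.\<close>
    also have "\<dots> = (2 * q + 2) * (2 * q + 1)"
    proof -
      obtain r where r: "q = p + r" using pq by (metis le_add_diff_inverse)
      obtain s where s: "p = s + 1" using p7 by (intro that[of "p - 1"]) simp
      show ?thesis unfolding r s by (simp add: algebra_simps)
    qed
    finally show ?thesis .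
  qed
  ultimately show ?thesis by (intro exI[of _ "\<lambda>c. D1 c \<union> D2 c"] conjI ballI)
qed

end

section \<open>The two families of orders\<close>

lemma CHAR_mod_ring: "CHAR('p::prime_card mod_ring) = CARD('p)"
  by (rule CHAR_eqI) (auto dest: of_nat_0_mod_ring_dvd)

lemma cover_number_le_prime:
  assumes p: "CARD('p::prime_card) = p" "p + 1 = 2 ^ k" "odd k" "p mod 12 = 7"
    and n: "n \<ge> 1" and v: "v = 2 * p ^ n + 2" and m: "m \<ge> 3"
  shows "real (cover_number ((m - 1) * v) 6 3 m) \<le> (real v)\<^sup>2 * (real v - 1) * (real m - 1) / 24"
proof -
  have C: "CHAR('p mod_ring alg_closure) = p" by (simp add: CHAR_mod_ring p(1))
  have pr: "prime CHAR('p mod_ring alg_closure)" unfolding C using prime_card[where 'a='p] p(1) by simp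
  define F where "F = {x :: 'p mod_ring alg_closure. x ^ (p ^ n) = x}"
  define K where "K = {x :: 'p mod_ring alg_closure. x ^ (p ^ 1) = x}"
  have KF: "K \<subseteq> F"
  proof
    fix x assume "x \<in> K"
    then have x: "x ^ p = x" by (simp add: K_def)
    have "x ^ (p ^ j) = x" for j by (induction j) (simp_all add: x power_mult)
    then show "x \<in> F" by (simp add: F_def)
  qed
  have cF: "card F = p ^ n" using card_frobenius_fixed[OF pr n] unfolding C F_def .
  have p0: "p > 0" using p(4) by (auto intro!: Nat.gr0I)
  interpret subfield_pair F K p "p ^ n"
  proof
    show "subfield_set F" using subfield_set_frobenius_fixed[OF pr, of n] unfolding C F_def .
    show "subfield_set K" using subfield_set_frobenius_fixed[OF pr, of 1] unfolding C K_def .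
    show "card K = p" using card_frobenius_fixed[OF pr order_refl] unfolding C K_def by simp
    show "finite F" using cF p0 by (intro card_ge_0_finite) simp
  qed (use KF cF in auto)
  have "CARD('p mod_ring) = p" using p(1) by simp
  from ex_resolved[OF p(2,3) this p(4)] obtain D where
    D: "resolved (insert None (Some ` F) \<times> (UNIV :: bool set)) F D"
      "\<And>c. c \<in> F \<Longrightarrow> 12 * card (D c) \<le> (2 * p ^ n + 2) * (2 * p ^ n + 1)" by blast
  show ?thesis
  proof (rule cover_number_le_resolved[OF D(1)])
    show "finite (insert None (Some ` F) \<times> (UNIV :: bool set))" using finF by simp
    show "card (insert None (Some ` F) \<times> (UNIV :: bool set)) = v"
      using finF cF by (simp add: card_cartesian_product card_image v)
    show "even v" by (simp add: v)
    show "v \<ge> 4" using p0 by (simp add: v)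
    show "finite F" by (rule finF)
    show "F \<noteq> {}" using F_closed(1) by blast
    show "card F \<le> v div 2" by (simp add: cF v)
    show "12 * card (D c) \<le> v * (v - 1)" if "c \<in> F" for c using D(2)[OF that] by (simp add: v)
  qed (rule m)
qed

lemma cover_number_le_power4:
  assumes n: "n \<ge> 1" and m: "m \<ge> 3"
  shows "real (cover_number ((m - 1) * 4 ^ n) 6 3 m) \<le> (real (4 ^ n))\<^sup>2 * (real (4 ^ n) - 1) * (real m - 1) / 24"
proof -
  \<comment> \<open>One of the 2 n binary dimensions is the level, so the field has degree 2 n - 1.
    This is odd, which is why powers of 4 appear.\<close>
  define k where "k = 2 * n - 1"
  have dim: "odd k" "2 * 2 ^ k = (4 ^ n :: nat)"
  proof -
    show "odd k" using n by (simp add: k_def)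
    have "2 * 2 ^ k = (2::nat) ^ (2 * n)" using n by (simp add: k_def flip: power_Suc)
    then show "2 * 2 ^ k = (4 ^ n :: nat)" by (simp add: power_mult)
  qed
  interpret odd_binary_field "{x::gf2 alg_closure. x ^ (2 ^ k) = x}" k by (rule odd_binary_field_gf2[OF dim(1)])
  let ?S = "{x::gf2 alg_closure. x ^ (2 ^ k) = x}"
  have v: "card V = 4 ^ n" using card_V dim(2) by simp
  show ?thesis
  proof (rule cover_number_le_resolved[OF planes_resolved finite_V v])
    show "even (4 ^ n :: nat)" using n by simp
    show "(4 :: nat) \<le> 4 ^ n" using n by (metis one_le_numeral power_increasing power_one_right)
    show "finite (?S - {0})" by simp
    show "?S - {0} \<noteq> {}" using S_closed(2) by (metis (no_types, lifting) Diff_iff empty_iff singletonD zero_neq_one)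
    have "card (?S - {0}) \<le> card ?S" by (rule card_mono) auto
    also have "\<dots> = 4 ^ n div 2" using cardS dim(2) by simp
    finally show "card (?S - {0}) \<le> 4 ^ n div 2" .
    show "12 * card (planes c) \<le> 4 ^ n * (4 ^ n - 1)" if "c \<in> ?S - {0}" for c
      using card_planes[of c] that v by simp
  qed (rule m)
qed

text \<open>Index types of prime size, so that \<open>mod_ring\<close> over them is GF(p).\<close>

typedef seven = "{0..<7::nat}" by (rule exI[of _ 0]) simp
typedef thirty_one = "{0..<31::nat}" by (rule exI[of _ 0]) simp
typedef one_hundred_twenty_seven = "{0..<127::nat}" by (rule exI[of _ 0]) simp

lemma CARD_seven: "CARD(seven) = 7"
  by (simp add: type_definition.card[OF type_definition_seven])
lemma CARD_thirty_one: "CARD(thirty_one) = 31"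
  by (simp add: type_definition.card[OF type_definition_thirty_one])
lemma CARD_one_hundred_twenty_seven: "CARD(one_hundred_twenty_seven) = 127"
  by (simp add: type_definition.card[OF type_definition_one_hundred_twenty_seven])

instance seven :: prime_card by standard (simp add: CARD_seven)
instance thirty_one :: prime_card by standard (simp add: CARD_thirty_one)
instance one_hundred_twenty_seven :: prime_card by standard (simp add: CARD_one_hundred_twenty_seven)

theorem theorem14:
  fixes n v m :: nat
  assumes "n \<ge> 1"
    and "v = 4 ^ n \<or> (\<exists>p\<in>{7, 31, 127}. v = 2 * p ^ n + 2)"
    and "m \<ge> 3"
  shows "real (cover_number ((m - 1) * v) 6 3 m)
           \<le> (real v)\<^sup>2 * (real v - 1) * (real m - 1) / 24"
proof -
  consider "v = 4 ^ n" | "v = 2 * 7 ^ n + 2" | "v = 2 * 31 ^ n + 2" | "v = 2 * 127 ^ n + 2"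
    using assms(2) by blast
  then show ?thesis
  proof cases
    case 1
    show ?thesis unfolding 1 by (rule cover_number_le_power4[OF assms(1,3)])
  next
    case 2
    \<comment> \<open>The last argument is the exponent k with p + 1 = 2^k: 8 = 2^3, and below 32 =
      2^5 and 128 = 2^7.\<close>
    show ?thesis by (rule cover_number_le_prime[OF CARD_seven _ _ _ assms(1) 2 assms(3), of 3]) simp_all
  next
    case 3
    show ?thesis by (rule cover_number_le_prime[OF CARD_thirty_one _ _ _ assms(1) 3 assms(3), of 5]) simp_all
  next
    case 4
    show ?thesis by (rule cover_number_le_prime[OF CARD_one_hundred_twenty_seven _ _ _ assms(1) 4 assms(3), of 7]) simp_all
  qed
qed

end
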